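(* Let $Z$ be a countable set in $\mathbb{R}^d\setminus\{0\}$ and let $r_z>R_0$, $z\in Z$, be such that the balls $B(z,r_z)$, $z\in Z$, are pairwise disjoint. Suppose that these balls satisfy the separation condition, that is, $Z$ is locally finite (every bounded subset of $\mathbb{R}^d$ contains only finitely many points of $Z$) and $$\inf_{z,z'\in Z,\ z\neq z'} \frac{|z-z'|^d}{|z|^d}\,\frac{g(r_z)}{g(|z|)}>0 .$$ If $$\sum_{z\in Z}\frac{g(|z|)}{g(r_z)}=\infty ,$$ then the union $A:=\bigcup_{z\in Z}B(z,r_z)$ is unavoidable.
   Context: Let $d\ge 1$. $\mathbb{P}=(P_t)_{t>0}$ is a right continuous Markov semigroup on $\mathbb{R}^d$ (Markov kernels with $P_sP_t=P_{s+t}$, $P_t1=1$, and $\lim_{t\to 0}P_tf(x)=f(x)$ for every $x\in\mathbb{R}^d$ and every continuous $f$ with compact support). A Borel function $v:\mathbb{R}^d\to[0,\infty]$ is $\mathbb{P}$-excessive if $\sup_{t>0}P_tv=v$. It is assumed that the potential kernel $V_0:=\int_0^\infty P_t\,dt$ is given by convolution with a $\mathbb{P}$-excessive function $G_0=g(|\cdot|)$, i.e. $V_0f(x)=\int_{\mathbb{R}^d} G_0(x-y)f(y)\,dy$ for all Borel $f\ge 0$, where $g$ is a decreasing (i.e. non-increasing) function on $[0,\infty)$ with $0<g<\infty$ on $(0,\infty)$, $\lim_{r\to 0}g(r)=g(0)=\infty$, and the following hold. (LD) There are $R_0\ge 0$ and $C_G\ge 1$ such that $d\int_0^r s^{d-1}g(s)\,ds\le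 C_G\,r^dg(r)$ for all $r>R_0$. (UD) There are $R_1\ge 0$, $\eta_0\in(0,1)$ and $K>1$ such that $g(Kr)\le\eta_0\, g(r)$ for all $r>R_1$. The constant $R_0$ is fixed as in (LD). $B(x,r)$ denotes the open ball with center $x$ and radius $r$. Let $(\Omega,\mathfrak M,\mathfrak M_t,X_t,\theta_t,P^x)$ be a Hunt process on $\mathbb{R}^d$ with transition semigroup $\mathbb{P}$ (such a process exists). For Borel $A\subset\mathbb{R}^d$, $T_A(\omega):=\inf\{t\ge 0: X_t(\omega)\in A\}$. A Borel set $A$ is called unavoidable if $P^x[T_A<\infty]=1$ for every $x\in\mathbb{R}^d$; otherwise it is called avoidable. *)

theory Defs
  imports "HOL-Probability.Probability"
begin

text \<open>The Euclidean space of dimension \<open>d \<ge> 1\<close> is an arbitrary type of class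
  \<open>euclidean_space\<close> with \<open>d = DIM('v)\<close>. Numerical functions with values in \<open>[0, \<infinity>]\<close> have
  type \<open>ennreal\<close>, so that \<open>g 0 = \<infinity>\<close> is literally true.\<close>

text \<open>Only the kernels \<open>Q t\<close> with \<open>t > 0\<close> are relevant; \<open>Q s x \<bind> Q t\<close> is the measure
  \<open>B \<mapsto> \<integral> Q t y B (Q s x)(dy)\<close>.\<close>

locale markov_semigroup =
  fixes Q :: "real \<Rightarrow> 'v::euclidean_space \<Rightarrow> 'v measure"
  assumes kernel: "0 < t \<Longrightarrow> Q t \<in> borel \<rightarrow>\<^sub>M prob_algebra borel"
    and semigroup: "0 < s \<Longrightarrow> 0 < t \<Longrightarrow> Q (s + t) x = (Q s x \<bind> Q t)"
    and right_continuous: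
      "continuous_on UNIV f \<Longrightarrow> compact (closure {y. f y \<noteq> (0::real)}) \<Longrightarrow>
        ((\<lambda>t. \<integral>y. f y \<partial>Q t x) \<longlongrightarrow> f x) (at_right 0)"

definition excessive :: "(real \<Rightarrow> 'v::euclidean_space \<Rightarrow> 'v measure) \<Rightarrow> ('v \<Rightarrow> ennreal) \<Rightarrow> bool" where
  "excessive Q v \<longleftrightarrow> v \<in> borel_measurable borel \<and>
    (\<forall>x. (SUP t\<in>{0<..}. \<integral>\<^sup>+y. v y \<partial>Q t x) = v x)"

definition potential_kernel ::
  "(real \<Rightarrow> 'v::euclidean_space \<Rightarrow> 'v measure) \<Rightarrow> ('v \<Rightarrow> ennreal) \<Rightarrow> 'v \<Rightarrow> ennreal" where
  "potential_kernel Q f x = (\<integral>\<^sup>+t\<in>{0<..}. (\<integral>\<^sup>+y. f y \<partial>Q t x) \<partial>lborel)"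

text \<open>The function \<open>g\<close> is only meant on \<open>[0, \<infinity>)\<close>; its values on negative reals play no role.\<close>

locale isotropic_potential = markov_semigroup Q
  for Q :: "real \<Rightarrow> 'v::euclidean_space \<Rightarrow> 'v measure" +
  fixes g :: "real \<Rightarrow> ennreal" and R0 :: real
  assumes g_decreasing: "monotone_on {0..} (\<le>) (\<ge>) g"
    and g_pos_finite: "0 < r \<Longrightarrow> 0 < g r \<and> g r < \<infinity>"
    and g_zero: "g 0 = \<infinity>"
    and g_lim: "(g \<longlongrightarrow> \<infinity>) (at_right 0)"
    and G0_excessive: "excessive Q (\<lambda>x. g (norm x))"
    and potential_kernel_eq: "f \<in> borel_measurable borel \<Longrightarrow>
      potential_kernel Q f x = (\<integral>\<^sup>+y. g (norm (x - y)) * f y \<partial>lborel)"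
    and R0_nonneg: "0 \<le> R0"
    and LD: "\<exists>C\<ge>1. \<forall>r>R0.
      of_nat DIM('v) * (\<integral>\<^sup>+s\<in>{0<..<r}. ennreal (s ^ (DIM('v) - 1)) * g s \<partial>lborel)
        \<le> ennreal (C * r ^ DIM('v)) * g r"
    and UD: "\<exists>R1\<ge>0. \<exists>\<eta>. 0 < \<eta> \<and> \<eta> < 1 \<and> (\<exists>K>1. \<forall>r>R1. g (K * r) \<le> ennreal \<eta> * g r)"

text \<open>Hunt processes on the whole Euclidean space whose transition semigroup is \<open>Q\<close>. As the kernels
  \<open>Q t\<close> have total mass 1, no cemetery point is adjoined.

  The filtration is indexed by \<open>[0, \<infinity>]\<close> (type \<open>ennreal\<close>), because stopping times may be infinite;
  \<open>F \<infinity>\<close> is some sub-\<open>\<sigma>\<close>-algebra of \<open>M\<close> containing all the others. The value of the process at a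
  finite stopping time \<open>T\<close> is \<open>X (enn2real (T \<omega>)) \<omega>\<close>. The measure \<open>M\<close> only carries the underlying
  set and its \<open>\<sigma>\<close>-algebra. The filtration is not required to be complete.

  \<open>strong_markov\<close> says that \<open>P\<^sup>x[X (T + s) \<in> B | F T] = P\<^bsup>X T\<^esup>[X s \<in> B]\<close> holds \<open>P\<^sup>x\<close>-almost surely
  on \<open>{T < \<infinity>}\<close>, integrated over the events \<open>L \<in> F T\<close>; constant \<open>T\<close> gives the Markov property.\<close>

locale hunt_process = markov_semigroup Q + filtration "space M" F
  for Q :: "real \<Rightarrow> 'v::euclidean_space \<Rightarrow> 'v measure"
    and M :: "'w measure"
    and F :: "ennreal \<Rightarrow> 'w measure" +
  fixes X :: "real \<Rightarrow> 'w \<Rightarrow> 'v"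
    and \<theta> :: "real \<Rightarrow> 'w \<Rightarrow> 'w"
    and P :: "'v \<Rightarrow> 'w measure"
  assumes F_le: "sets (F t) \<subseteq> sets M"
    and F_right_continuous: "t < \<infinity> \<Longrightarrow> sets (F t) = (\<Inter>u\<in>{t<..}. sets (F u))"
    and prob: "prob_space (P x)"
    and sets_P: "sets (P x) = sets M"
    and adapted: "0 \<le> t \<Longrightarrow> X t \<in> F (ennreal t) \<rightarrow>\<^sub>M borel"
    and shift_space: "0 \<le> t \<Longrightarrow> \<omega> \<in> space M \<Longrightarrow> \<theta> t \<omega> \<in> space M"
    and shift: "0 \<le> s \<Longrightarrow> 0 \<le> t \<Longrightarrow> \<omega> \<in> space M \<Longrightarrow> X s (\<theta> t \<omega>) = X (t + s) \<omega>"
    and path_right_continuous: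
      "0 \<le> t \<Longrightarrow> \<omega> \<in> space M \<Longrightarrow> ((\<lambda>s. X s \<omega>) \<longlongrightarrow> X t \<omega>) (at_right t)"
    and path_left_limits:
      "AE \<omega> in P x. \<forall>t>0. \<exists>l. ((\<lambda>s. X s \<omega>) \<longlongrightarrow> l) (at_left t)"
    and normal: "AE \<omega> in P x. X 0 \<omega> = x"
    and transition: "0 < t \<Longrightarrow> distr (P x) borel (X t) = Q t x"
    and strong_markov:
      "stopping_time F T \<Longrightarrow> L \<in> sets (pre_sigma T) \<Longrightarrow> 0 \<le> s \<Longrightarrow> B \<in> sets borel \<Longrightarrow>
        emeasure (P x) {\<omega> \<in> L. T \<omega> < \<infinity> \<and> X (enn2real (T \<omega>) + s) \<omega> \<in> B} =
        (\<integral>\<^sup>+\<omega>\<in>{\<omega> \<in> L. T \<omega> < \<infinity>}.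
          emeasure (P (X (enn2real (T \<omega>)) \<omega>)) {\<omega>' \<in> space M. X s \<omega>' \<in> B} \<partial>P x)"
    and quasi_left_continuous:
      "(\<And>n. stopping_time F (S n)) \<Longrightarrow> (\<And>n \<omega>. \<omega> \<in> space M \<Longrightarrow> S n \<omega> \<le> S (Suc n) \<omega>) \<Longrightarrow>
        AE \<omega> in P x. (SUP n. S n \<omega>) < \<infinity> \<longrightarrow>
          (\<lambda>n. X (enn2real (S n \<omega>)) \<omega>) \<longlonglongrightarrow> X (enn2real (SUP n. S n \<omega>)) \<omega>"

definition hitting_time :: "(real \<Rightarrow> 'w \<Rightarrow> 'v) \<Rightarrow> 'v set \<Rightarrow> 'w \<Rightarrow> ennreal" where
  "hitting_time X A \<omega> = (INF t\<in>{t. 0 \<le> t \<and> X t \<omega> \<in> A}. ennreal t)"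

text \<open>For general Borel sets \<open>A\<close> the event \<open>T\<^sub>A < \<infinity>\<close> is only measurable with respect to the
  completion of \<open>P x\<close>.\<close>

definition unavoidable ::
  "(real \<Rightarrow> 'w \<Rightarrow> 'v::euclidean_space) \<Rightarrow> ('v \<Rightarrow> 'w measure) \<Rightarrow> 'v set \<Rightarrow> bool" where
  "unavoidable X P A \<longleftrightarrow> A \<in> sets borel \<and>
    (\<forall>x. emeasure (completion (P x)) {\<omega> \<in> space (P x). hitting_time X A \<omega> < \<infinity>} = 1)"

definition locally_finite_set :: "'v::euclidean_space set \<Rightarrow> bool" where
  "locally_finite_set Z \<longleftrightarrow> (\<forall>S. bounded S \<longrightarrow> finite (Z \<inter> S))"

text \<open>The infimum is taken in \<open>[0, \<infinity>]\<close>; it is \<open>\<infinity>\<close> if \<open>Z\<close> has at most one point.\<close>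

definition separation_condition ::
  "(real \<Rightarrow> ennreal) \<Rightarrow> 'v::euclidean_space set \<Rightarrow> ('v \<Rightarrow> real) \<Rightarrow> bool" where
  "separation_condition g Z r \<longleftrightarrow> locally_finite_set Z \<and>
    0 < (INF (z, z')\<in>{(z, z'). z \<in> Z \<and> z' \<in> Z \<and> z \<noteq> z'}.
      ennreal (norm (z - z') ^ DIM('v) / norm z ^ DIM('v)) * (g (r z) / g (norm z)))"

end

theory Submission
  imports Defs
begin

text \<open>
  Hitting probabilities are compared with potentials. Write \<open>V\<close> for the potential kernel, \<open>A\<close> for
  the union of the balls and \<open>d\<close> for the dimension.

  Let \<open>f \<ge> 0\<close> vanish outside \<open>A\<close> and let \<open>V f \<le> c\<close> everywhere. Before it enters \<open>A\<close>, the process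
  collects nothing of \<open>f\<close>; after that, it collects at most \<open>c\<close> in expectation. Hence
  \<open>V f x \<le> c * P\<^sup>x[A is hit]\<close>, and the same argument from a time \<open>t\<close> on, on an event
  \<open>L\<close> of the past, gives \<open>E\<^sup>x[V f (X t); L] \<le> c * P\<^sup>x[L, A is hit]\<close> (lemma
  \<open>potential_le_hitting\<close>). Suppose that there is a \<open>\<delta> > 0\<close> such that for every \<open>N\<close> a function \<open>f\<close>
  of this kind has \<open>V f \<ge> \<delta> * c\<close> on \<open>{norm x \<le> N}\<close>. Then \<open>P\<^sup>x[L, A is hit] \<ge> \<delta> * P\<^sup>x[L]\<close> for all
  \<open>L\<close>. For \<open>L = {A is not hit up to time n}\<close> and \<open>n \<rightarrow> \<infinity>\<close> the left side tends to 0 and the right side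
  to \<open>\<delta> * P\<^sup>x[A is not hit]\<close>, so that \<open>A\<close> is unavoidable (lemma \<open>unavoidable_if_potentials\<close>).

  The functions \<open>f\<close> are sums of the indicators of the balls \<open>B(z, r z)\<close>, each divided by
  \<open>r z ^ d * g (r z)\<close> and the volume of the unit ball, over a finite set \<open>F\<close> of centres far away from the
  origin whose balls do not contain the origin. Condition (LD) makes \<open>g\<close> doubling and bounds the integral of \<open>g (norm u)\<close> over \<open>B(0, r)\<close> by a
  multiple of \<open>r ^ d * g r\<close>; so the summand of \<open>z\<close> has at \<open>y\<close> a potential which is at most a multiple of
  \<open>min 1 (g (norm (y - z)) / g (r z))\<close>, and at least a multiple of the weight \<open>g (norm z) / g (r z)\<close> if
  \<open>norm y \<le> norm z\<close>. Let \<open>S\<close> be the sum of the weights over \<open>F\<close>; by divergence, \<open>F\<close> can be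
  chosen with \<open>S \<ge> 1\<close>. The potential of \<open>f\<close> is at least a multiple of \<open>S\<close> on \<open>{norm x \<le> N}\<close>, and it
  remains to bound it by a multiple of \<open>S\<close> everywhere.

  At a point \<open>y\<close>, the centre nearest to \<open>y\<close> contributes at most a constant, and every centre with
  \<open>norm (y - z) \<ge> norm z / 2\<close> contributes at most a multiple of its weight. For the others, the separation
  condition says that the balls around \<open>z\<close> with volume \<open>\<epsilon> * norm z ^ d * weight of z\<close> are disjoint for
  small \<open>\<epsilon>\<close>. As \<open>z\<close> is not nearest to \<open>y\<close>, the function \<open>g (norm (y - u))\<close> of \<open>u\<close> is on such a ball at
  least a multiple of \<open>g (norm (y - z))\<close>. So the sum of the remaining contributions is at most a multiple of
  the integral of \<open>g (norm (y - u))\<close> over \<open>B(y, 2 * norm y)\<close>, divided by \<open>norm y ^ d * g (2 * norm y)\<close>, and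
  this is bounded by (LD) (lemma \<open>near_sum_le\<close>).
\<close>

section \<open>Hitting probabilities and potentials of a Hunt process\<close>

text \<open>The least point strictly above \<open>s \<ge> 0\<close> of the grid of mesh \<open>1 / (n + 1)\<close>. Approaching \<open>s\<close> strictly
  from the right is what right-continuity of the paths can use.\<close>

definition grid_above :: "nat \<Rightarrow> real \<Rightarrow> real" where
  "grid_above n s = real (nat \<lfloor>s * real (Suc n)\<rfloor> + 1) / real (Suc n)"

lemma grid_above_bounds:
  assumes "0 \<le> s"
  shows "s < grid_above n s" "grid_above n s \<le> s + 1 / real (Suc n)"
proof -
  have "0 \<le> s * real (Suc n)" using assms by simp
  then have "real (nat \<lfloor>s * real (Suc n)\<rfloor>) = of_int \<lfloor>s * real (Suc n)\<rfloor>"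
    by (simp add: of_nat_nat)
  then have "s * real (Suc n) < real (nat \<lfloor>s * real (Suc n)\<rfloor> + 1)"
    "real (nat \<lfloor>s * real (Suc n)\<rfloor> + 1) \<le> s * real (Suc n) + 1"
    by linarith+
  then show "s < grid_above n s" "grid_above n s \<le> s + 1 / real (Suc n)"
    unfolding grid_above_def by (simp_all add: pos_less_divide_eq pos_divide_le_eq distrib_right)
qed

lemma grid_above_tendsto:
  assumes "0 \<le> s"
  shows "filterlim (\<lambda>n. grid_above n s) (at_right s) sequentially"
proof -
  have "(\<lambda>n. s + 1 / real (Suc n)) \<longlonglongrightarrow> s + 0"
    by (intro tendsto_intros LIMSEQ_Suc lim_1_over_n)
  then have "(\<lambda>n. grid_above n s) \<longlonglongrightarrow> s"
    using grid_above_bounds[OF assms]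
    by (intro tendsto_sandwich[of "\<lambda>_. s" "\<lambda>n. grid_above n s" sequentially "\<lambda>n. s + 1 / real (Suc n)"])
       (auto intro!: always_eventually less_imp_le)
  then show ?thesis
    using grid_above_bounds(1)[OF assms] by (auto simp: filterlim_at less_imp_neq[symmetric] intro!: always_eventually)
qed

context hunt_process
begin

lemma space_P [simp]: "space (P x) = space M"
  using sets_P by (rule sets_eq_imp_space_eq)

lemma measurable_P [simp]: "measurable (P x) N = measurable M N"
  by (rule measurable_cong_sets) (simp_all add: sets_P)

lemma X_measurable: "0 \<le> t \<Longrightarrow> X t \<in> borel_measurable M"
  using measurable_mono[OF order_refl _ F_le] adapted space_F by (metis subsetD)

lemma X_adapted_mono: "0 \<le> s \<Longrightarrow> s \<le> t \<Longrightarrow> X s \<in> borel_measurable (F (ennreal t))"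
  using measurable_mono[OF order_refl _ sets_F_mono[of "ennreal s" "ennreal t"], of borel] adapted[of s] space_F
  by (auto simp: ennreal_leI)

lemma grid_path_tendsto:
  assumes "0 \<le> s" "\<omega> \<in> space M"
  shows "(\<lambda>n. X (grid_above n s) \<omega>) \<longlonglongrightarrow> X s \<omega>"
  using path_right_continuous[OF assms] grid_above_tendsto[OF assms(1)] by (rule filterlim_compose)

text \<open>A right-continuous process is the limit of its values at grid points to the right, each of which
  takes countably many time values. This is what makes Fubini applicable to occupation times.
  Times are cut off at 0, because nothing is known about the process at negative times.\<close>

lemma paths_jointly_measurable:
  "(\<lambda>(\<omega>, s). X (max 0 s) \<omega>) \<in> borel_measurable (M \<Otimes>\<^sub>M borel)"
proof (rule borel_measurable_LIMSEQ_metric)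
  fix n
  have "(\<lambda>p. X (real (nat \<lfloor>max 0 (snd p) * real (Suc n)\<rfloor> + 1) / real (Suc n)) (fst p))
    \<in> borel_measurable (M \<Otimes>\<^sub>M borel)"
  proof (rule measurable_compose_countable[where f = "\<lambda>k p. X (real (k + 1) / real (Suc n)) (fst p)"])
    show "(\<lambda>p. X (real (k + 1) / real (Suc n)) (fst p)) \<in> borel_measurable (M \<Otimes>\<^sub>M borel)" for k
      by (rule measurable_compose[OF measurable_fst X_measurable]) simp
    show "(\<lambda>p. nat \<lfloor>max 0 (snd p) * real (Suc n)\<rfloor>) \<in> (M \<Otimes>\<^sub>M borel) \<rightarrow>\<^sub>M count_space UNIV"
      by measurable
  qed
  then show "(\<lambda>(\<omega>, s). X (grid_above n (max 0 s)) \<omega>) \<in> borel_measurable (M \<Otimes>\<^sub>M borel)"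
    by (simp add: grid_above_def split_beta')
next
  fix p :: "'w \<times> real" assume "p \<in> space (M \<Otimes>\<^sub>M borel)"
  then show "(\<lambda>n. case p of (\<omega>, s) \<Rightarrow> X (grid_above n (max 0 s)) \<omega>)
      \<longlonglongrightarrow> (case p of (\<omega>, s) \<Rightarrow> X (max 0 s) \<omega>)"
    by (auto simp: space_pair_measure intro!: grid_path_tendsto)
qed

lemma transition_integral_measurable_continuous:
  fixes \<phi> :: "'v \<Rightarrow> real"
  assumes cont: "continuous_on UNIV \<phi>" and bound: "\<And>y. 0 \<le> \<phi> y \<and> \<phi> y \<le> 1"
  shows "(\<lambda>(s, y). \<integral>\<omega>. \<phi> (X (max 0 s) \<omega>) \<partial>P y) \<in> borel_measurable (borel \<Otimes>\<^sub>M borel)"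
proof (rule borel_measurable_LIMSEQ_metric)
  have [measurable]: "\<phi> \<in> borel_measurable borel"
    using cont by (rule borel_measurable_continuous_onI)
  fix n
  have "(\<lambda>p. \<integral>z. \<phi> z \<partial>Q (real (nat \<lfloor>max 0 (fst p) * real (Suc n)\<rfloor> + 1) / real (Suc n)) (snd p))
    \<in> borel_measurable (borel \<Otimes>\<^sub>M borel)"
  proof (rule measurable_compose_countable[where f = "\<lambda>k p. \<integral>z. \<phi> z \<partial>Q (real (k + 1) / real (Suc n)) (snd p)"])
    fix k
    have "Q (real (k + 1) / real (Suc n)) \<in> borel \<rightarrow>\<^sub>M subprob_algebra borel"
      by (intro measurable_prob_algebraD kernel) simp
    from measurable_compose[OF this integral_measurable_subprob_algebra[of \<phi>]]
    have "(\<lambda>y. \<integral>z. \<phi> z \<partial>Q (real (k + 1) / real (Suc n)) y) \<in> borel_measurable borel"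
      by measurable
    from measurable_compose[OF measurable_snd this]
    show "(\<lambda>p. \<integral>z. \<phi> z \<partial>Q (real (k + 1) / real (Suc n)) (snd p)) \<in> borel_measurable (borel \<Otimes>\<^sub>M borel)" .
    show "(\<lambda>p. nat \<lfloor>max 0 (fst p) * real (Suc n)\<rfloor>) \<in> (borel \<Otimes>\<^sub>M borel) \<rightarrow>\<^sub>M count_space UNIV"
      by measurable
  qed
  moreover have "(\<integral>z. \<phi> z \<partial>Q (grid_above n (max 0 s)) y) = (\<integral>\<omega>. \<phi> (X (grid_above n (max 0 s)) \<omega>) \<partial>P y)" for s y
  proof -
    have pos: "0 < grid_above n (max 0 s)"
      using grid_above_bounds(1)[of "max 0 s" n] by simp
    show ?thesis
      unfolding transition[OF pos, symmetric]
      using X_measurable[of "grid_above n (max 0 s)"] pos by (intro integral_distr) auto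
  qed
  ultimately show "(\<lambda>(s, y). \<integral>\<omega>. \<phi> (X (grid_above n (max 0 s)) \<omega>) \<partial>P y) \<in> borel_measurable (borel \<Otimes>\<^sub>M borel)"
    by (simp add: grid_above_def split_beta')
next
  have [measurable]: "\<phi> \<in> borel_measurable borel"
    using cont by (rule borel_measurable_continuous_onI)
  fix p :: "real \<times> 'v"
  obtain s y where p: "p = (s, y)" by (cases p)
  interpret prob_space "P y" by (rule prob)
  have pos: "0 \<le> grid_above n (max 0 s)" for n
    using grid_above_bounds(1)[of "max 0 s" n] by simp
  have "(\<lambda>n. \<integral>\<omega>. \<phi> (X (grid_above n (max 0 s)) \<omega>) \<partial>P y) \<longlonglongrightarrow> (\<integral>\<omega>. \<phi> (X (max 0 s) \<omega>) \<partial>P y)"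
  proof (rule integral_dominated_convergence[where w = "\<lambda>_. 1"])
    show "(\<lambda>\<omega>. \<phi> (X (max 0 s) \<omega>)) \<in> borel_measurable (P y)"
      using X_measurable[of "max 0 s"] by auto
    show "(\<lambda>\<omega>. \<phi> (X (grid_above n (max 0 s)) \<omega>)) \<in> borel_measurable (P y)" for n
      using X_measurable[OF pos[of n]] by auto
    show "AE \<omega> in P y. (\<lambda>n. \<phi> (X (grid_above n (max 0 s)) \<omega>)) \<longlonglongrightarrow> \<phi> (X (max 0 s) \<omega>)"
    proof (rule AE_I2)
      fix \<omega> assume "\<omega> \<in> space (P y)"
      then have "(\<lambda>n. X (grid_above n (max 0 s)) \<omega>) \<longlonglongrightarrow> X (max 0 s) \<omega>"
        by (intro grid_path_tendsto) auto
      moreover have "isCont \<phi> (X (max 0 s) \<omega>)"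
        using cont by (simp add: continuous_on_eq_continuous_at)
      ultimately show "(\<lambda>n. \<phi> (X (grid_above n (max 0 s)) \<omega>)) \<longlonglongrightarrow> \<phi> (X (max 0 s) \<omega>)"
        by (rule isCont_tendsto_compose[rotated])
    qed
  qed (use bound in \<open>auto simp: abs_le_iff intro: order_trans\<close>)
  then show "(\<lambda>n. case p of (s, y) \<Rightarrow> \<integral>\<omega>. \<phi> (X (grid_above n (max 0 s)) \<omega>) \<partial>P y)
      \<longlonglongrightarrow> (case p of (s, y) \<Rightarrow> \<integral>\<omega>. \<phi> (X (max 0 s) \<omega>) \<partial>P y)"
    by (simp add: p)
qed

text \<open>Kernels are measurable in the starting point for each fixed positive time. Joint measurability follows
  for the integrals of continuous functions from right-continuity in time, then for open sets, whose
  indicators are increasing limits of continuous functions; open sets generate the Borel sets.\<close>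

lemma transition_jointly_measurable:
  "(\<lambda>(s, y). distr (P y) borel (X (max 0 s))) \<in> borel \<Otimes>\<^sub>M borel \<rightarrow>\<^sub>M prob_algebra borel"
proof (rule measurable_prob_algebra_generated[where \<Omega> = UNIV and G = "{S. open S}"])
  show "sets (borel::'v measure) = sigma_sets UNIV {S. open S}"
    by (simp add: borel_def)
  show "Int_stable {S::'v set. open S}"
    by (auto simp: Int_stable_def)
  show "{S. open S} \<subseteq> Pow (UNIV::'v set)" by simp
  fix p :: "real \<times> 'v"
  obtain s y where p: "p = (s, y)" by (cases p)
  show "prob_space (case p of (s, y) \<Rightarrow> distr (P y) borel (X (max 0 s)))"
    using X_measurable[of "max 0 s"]
    by (auto simp: p intro!: prob_space.prob_space_distr prob)
  show "sets (case p of (s, y) \<Rightarrow> distr (P y) borel (X (max 0 s))) = sets borel"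
    by (simp add: p)
next
  fix S :: "'v set" assume "S \<in> {S. open S}"
  then have S: "open S" by simp
  show "(\<lambda>p. emeasure (case p of (s, y) \<Rightarrow> distr (P y) borel (X (max 0 s))) S) \<in> borel_measurable (borel \<Otimes>\<^sub>M borel)"
  proof (cases "S = UNIV")
    case True
    have "emeasure (distr (P y) borel (X (max 0 s))) UNIV = 1" for s y
      using prob_space.emeasure_space_1[OF prob_space.prob_space_distr[OF prob], of "X (max 0 s)" y borel]
        X_measurable[of "max 0 s"] by simp
    then show ?thesis by (simp add: True split_beta')
  next
    case False
    define \<phi> :: "nat \<Rightarrow> 'v \<Rightarrow> real" where "\<phi> n y = min 1 (real n * infdist y (- S))" for n y
    have cont: "continuous_on UNIV (\<phi> n)" for n
      unfolding \<phi>_def by (intro continuous_intros)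
    have [measurable]: "\<phi> n \<in> borel_measurable borel" for n
      using cont by (rule borel_measurable_continuous_onI)
    have bound: "0 \<le> \<phi> n y \<and> \<phi> n y \<le> 1" for n y
      by (auto simp: \<phi>_def infdist_nonneg)
    have lim: "(\<lambda>n. \<phi> n y) \<longlonglongrightarrow> indicator S y" for y
    proof (cases "y \<in> S")
      case True
      then have pos: "infdist y (- S) > 0"
        using S False in_closed_iff_infdist_zero[of "- S" y] infdist_nonneg[of y "- S"]
        by (auto simp: less_le)
      obtain N where N: "1 < real N * infdist y (- S)"
        using reals_Archimedean3[OF pos] by blast
      have "\<forall>\<^sub>F n in sequentially. \<phi> n y = 1"
      proof (rule eventually_sequentiallyI[of N])
        fix n assume "N \<le> n"
        then have "real N * infdist y (- S) \<le> real n * infdist y (- S)"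
          using pos by (intro mult_right_mono) auto
        then show "\<phi> n y = 1" using N by (simp add: \<phi>_def)
      qed
      then show ?thesis using True by (simp add: tendsto_eventually)
    next
      case False
      then have "infdist y (- S) = 0" by (intro infdist_zero) simp
      then show ?thesis using False by (simp add: \<phi>_def)
    qed
    have lim2: "(\<lambda>n. \<integral>\<omega>. \<phi> n (X (max 0 s) \<omega>) \<partial>P y) \<longlonglongrightarrow> measure (distr (P y) borel (X (max 0 s))) S" for s y
    proof -
      interpret prob_space "P y" by (rule prob)
      have [measurable]: "X (max 0 s) \<in> borel_measurable M"
        using X_measurable[of "max 0 s"] by simp
      have [measurable]: "S \<in> sets borel" using S by simp
      have "(\<lambda>n. \<integral>\<omega>. \<phi> n (X (max 0 s) \<omega>) \<partial>P y) \<longlonglongrightarrow> (\<integral>\<omega>. indicator S (X (max 0 s) \<omega>) \<partial>P y)"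
        by (rule integral_dominated_convergence[where w = "\<lambda>_. 1"])
           (use bound lim in \<open>auto simp: abs_le_iff intro: order_trans\<close>)
      also have "(\<integral>\<omega>. indicat_real S (X (max 0 s) \<omega>) \<partial>P y) = (\<integral>z. indicat_real S z \<partial>distr (P y) borel (X (max 0 s)))"
        by (subst integral_distr) auto
      also have "\<dots> = measure (distr (P y) borel (X (max 0 s))) S"
        by simp
      finally show ?thesis .
    qed
    have "(\<lambda>(s, y). measure (distr (P y) borel (X (max 0 s))) S) \<in> borel_measurable (borel \<Otimes>\<^sub>M borel)"
      by (rule borel_measurable_LIMSEQ_metric[OF transition_integral_measurable_continuous[OF cont bound]])
         (auto intro: lim2)
    then have "(\<lambda>p. ennreal (case p of (s, y) \<Rightarrow> measure (distr (P y) borel (X (max 0 s))) S)) \<in> borel_measurable (borel \<Otimes>\<^sub>M borel)"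
      by measurable
    moreover have "ennreal (case p of (s, y) \<Rightarrow> measure (distr (P y) borel (X (max 0 s))) S) =
      emeasure (case p of (s, y) \<Rightarrow> distr (P y) borel (X (max 0 s))) S" for p :: "real \<times> 'v"
    proof -
      obtain s y where p: "p = (s, y)" by (cases p)
      interpret prob_space "distr (P y) borel (X (max 0 s))"
        using X_measurable[of "max 0 s"] by (intro prob_space.prob_space_distr prob) simp
      show ?thesis by (simp add: p emeasure_eq_measure)
    qed
    ultimately show ?thesis by simp
  qed
qed

text \<open>The strong Markov property at a constant time, extended from indicators to nonnegative functions.\<close>

lemma markov_property:
  assumes t: "0 \<le> t" and s: "0 < s" and L: "L \<in> sets (F (ennreal t))"
    and f: "f \<in> borel_measurable borel"
  shows "(\<integral>\<^sup>+\<omega>\<in>L. f (X (t + s) \<omega>) \<partial>P x) = (\<integral>\<^sup>+\<omega>\<in>L. (\<integral>\<^sup>+y. f y \<partial>Q s (X t \<omega>)) \<partial>P x)"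
  using f
proof (induction f rule: borel_measurable_induct)
  have LM [measurable]: "L \<in> sets M" using L F_le by auto
  have X1 [measurable]: "X t \<in> borel_measurable M" and X2 [measurable]: "X (t + s) \<in> borel_measurable M"
    using t s by (auto intro: X_measurable)
  have sp: "space (Q s z) = UNIV" "sets (Q s z) = sets borel" for z
    by (simp_all add: transition[OF s, symmetric])
  have QM [measurable]: "Q s \<in> borel \<rightarrow>\<^sub>M subprob_algebra borel"
    by (intro measurable_prob_algebraD kernel s)
  have inner: "(\<lambda>\<omega>. \<integral>\<^sup>+y. h y \<partial>Q s (X t \<omega>)) \<in> borel_measurable M"
    if "h \<in> borel_measurable borel" for h :: "'v \<Rightarrow> ennreal"
    using nn_integral_measurable_subprob_algebra[OF that] by measurable
  {
    case (cong f g)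
    then show ?case by (simp add: fun_eq_iff[symmetric])
  next
    case (set B)
    have "(\<integral>\<^sup>+\<omega>\<in>L. indicator B (X (t + s) \<omega>) \<partial>P x) = (\<integral>\<^sup>+\<omega>. indicator {\<omega> \<in> L. X (t + s) \<omega> \<in> B} \<omega> \<partial>P x)"
      by (intro nn_integral_cong) (auto split: split_indicator)
    also have "\<dots> = emeasure (P x) {\<omega> \<in> L. X (t + s) \<omega> \<in> B}"
    proof (rule nn_integral_indicator)
      have "{\<omega> \<in> L. X (t + s) \<omega> \<in> B} = L \<inter> (X (t + s) -` B \<inter> space M)"
        using sets.sets_into_space[OF LM] by auto
      also have "\<dots> \<in> sets M" using set by measurable
      finally show "{\<omega> \<in> L. X (t + s) \<omega> \<in> B} \<in> sets (P x)" by (simp add: sets_P)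
    qed
    also have "\<dots> = (\<integral>\<^sup>+\<omega>\<in>L. emeasure (P (X t \<omega>)) {\<omega>' \<in> space M. X s \<omega>' \<in> B} \<partial>P x)"
    proof -
      have "L \<in> sets (pre_sigma (\<lambda>_. ennreal t))"
      proof (rule sets_pre_sigmaI[OF stopping_time_const])
        fix u
        show "{\<omega> \<in> L. ennreal t \<le> u} \<in> sets (F u)"
          using L sets_F_mono[of "ennreal t" u] by (cases "ennreal t \<le> u") auto
      qed
      from strong_markov[OF stopping_time_const this less_imp_le[OF s] set, of x]
      show ?thesis using t by simp
    qed
    also have "\<dots> = (\<integral>\<^sup>+\<omega>\<in>L. (\<integral>\<^sup>+y. indicator B y \<partial>Q s (X t \<omega>)) \<partial>P x)"
    proof -
      have "emeasure (P z) {\<omega>' \<in> space M. X s \<omega>' \<in> B} = (\<integral>\<^sup>+y. indicator B y \<partial>Q s z)" for z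
      proof -
        have "(\<integral>\<^sup>+y. indicator B y \<partial>Q s z) = emeasure (distr (P z) borel (X s)) B"
          using set by (simp add: transition[OF s, symmetric])
        also have "\<dots> = emeasure (P z) (X s -` B \<inter> space M)"
          using set X_measurable[of s] s by (subst emeasure_distr) auto
        also have "X s -` B \<inter> space M = {\<omega>' \<in> space M. X s \<omega>' \<in> B}" by auto
        finally show ?thesis by simp
      qed
      then show ?thesis by simp
    qed
    finally show ?case .
  next
    case (mult u c)
    have "(\<integral>\<^sup>+\<omega>\<in>L. c * u (X (t + s) \<omega>) \<partial>P x) = c * (\<integral>\<^sup>+\<omega>\<in>L. u (X (t + s) \<omega>) \<partial>P x)"
      using mult(2) by (simp add: mult.assoc nn_integral_cmult sets_P)
    also have "\<dots> = (\<integral>\<^sup>+\<omega>\<in>L. c * (\<integral>\<^sup>+y. u y \<partial>Q s (X t \<omega>)) \<partial>P x)"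
      using inner[OF mult(2)] mult.IH by (simp add: mult.assoc nn_integral_cmult sets_P)
    also have "\<dots> = (\<integral>\<^sup>+\<omega>\<in>L. (\<integral>\<^sup>+y. c * u y \<partial>Q s (X t \<omega>)) \<partial>P x)"
      using mult(2) by (subst nn_integral_cmult) (auto cong: measurable_cong_sets simp: sp)
    finally show ?case .
  next
    case (add u v)
    have "(\<integral>\<^sup>+\<omega>\<in>L. v (X (t + s) \<omega>) + u (X (t + s) \<omega>) \<partial>P x)
      = (\<integral>\<^sup>+\<omega>\<in>L. v (X (t + s) \<omega>) \<partial>P x) + (\<integral>\<^sup>+\<omega>\<in>L. u (X (t + s) \<omega>) \<partial>P x)"
      using add(1,3) by (simp add: distrib_right nn_integral_add sets_P)
    also have "\<dots> = (\<integral>\<^sup>+\<omega>\<in>L. (\<integral>\<^sup>+y. v y \<partial>Q s (X t \<omega>)) + (\<integral>\<^sup>+y. u y \<partial>Q s (X t \<omega>)) \<partial>P x)"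
      using inner[OF add(1)] inner[OF add(3)] add by (simp add: distrib_right nn_integral_add sets_P)
    also have "\<dots> = (\<integral>\<^sup>+\<omega>\<in>L. (\<integral>\<^sup>+y. v y + u y \<partial>Q s (X t \<omega>)) \<partial>P x)"
      using add by (subst nn_integral_add) (auto cong: measurable_cong_sets simp: sp)
    finally show ?case .
  next
    case (seq U)
    have U [measurable]: "U i \<in> borel_measurable borel" for i by (rule seq)
    have "(\<integral>\<^sup>+\<omega>\<in>L. (SUP i. U i) (X (t + s) \<omega>) \<partial>P x) = (\<integral>\<^sup>+\<omega>. (SUP i. U i (X (t + s) \<omega>) * indicator L \<omega>) \<partial>P x)"
      by (simp add: image_comp SUP_mult_right_ennreal)
    also have "\<dots> = (SUP i. \<integral>\<^sup>+\<omega>\<in>L. U i (X (t + s) \<omega>) \<partial>P x)"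
      using seq(3) by (intro nn_integral_monotone_convergence_SUP)
        (auto simp: incseq_def le_fun_def sets_P intro!: mult_right_mono)
    also have "\<dots> = (SUP i. \<integral>\<^sup>+\<omega>\<in>L. (\<integral>\<^sup>+y. U i y \<partial>Q s (X t \<omega>)) \<partial>P x)"
      using seq by simp
    also have "\<dots> = (\<integral>\<^sup>+\<omega>. (SUP i. (\<integral>\<^sup>+y. U i y \<partial>Q s (X t \<omega>)) * indicator L \<omega>) \<partial>P x)"
      using seq(3) inner[OF U] by (intro nn_integral_monotone_convergence_SUP[symmetric])
        (auto simp: incseq_def le_fun_def sets_P intro!: mult_right_mono nn_integral_mono)
    also have "\<dots> = (\<integral>\<^sup>+\<omega>\<in>L. (SUP i. \<integral>\<^sup>+y. U i y \<partial>Q s (X t \<omega>)) \<partial>P x)"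
      by (simp add: SUP_mult_right_ennreal)
    also have "\<dots> = (\<integral>\<^sup>+\<omega>\<in>L. (\<integral>\<^sup>+y. (SUP i. U i y) \<partial>Q s (X t \<omega>)) \<partial>P x)"
      using seq(3) by (subst nn_integral_monotone_convergence_SUP) (auto cong: measurable_cong_sets simp: sp)
    finally show ?case by (simp add: image_comp)
  }
qed

text \<open>Integrating the Markov property over time: given the past up to time \<open>t\<close>, the expected amount of
  \<open>f\<close> that is collected after time \<open>t\<close> is the potential of \<open>f\<close> at the present position.\<close>

lemma markov_property_potential:
  assumes t: "0 \<le> t" and L: "L \<in> sets (F (ennreal t))" and f: "f \<in> borel_measurable borel"
  shows "(\<integral>\<^sup>+\<omega>\<in>L. (\<integral>\<^sup>+s\<in>{t<..}. f (X s \<omega>) \<partial>lborel) \<partial>P x)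
    = (\<integral>\<^sup>+\<omega>\<in>L. potential_kernel Q f (X t \<omega>) \<partial>P x)"
proof -
  note f [measurable]
  have LM [measurable]: "L \<in> sets M" using L F_le by auto
  have [measurable]: "X t \<in> borel_measurable M" using t by (rule X_measurable)
  interpret Px: prob_space "P x" by (rule prob)
  interpret pair_sigma_finite "P x" lborel ..
  have sets_pair [measurable_cong]: "sets (P x \<Otimes>\<^sub>M lborel) = sets (M \<Otimes>\<^sub>M borel)"
    by (intro sets_pair_measure_cong sets_P) simp
  have path: "(\<lambda>p. f (X (max 0 (snd p)) (fst p))) \<in> borel_measurable (M \<Otimes>\<^sub>M borel)"
    using measurable_compose[OF paths_jointly_measurable f] by (simp add: split_beta')
  have shift: "(\<integral>\<^sup>+s\<in>{t<..}. f (X s \<omega>) \<partial>lborel) = (\<integral>\<^sup>+s\<in>{0<..}. f (X (t + s) \<omega>) \<partial>lborel)" if "\<omega> \<in> space M" for \<omega>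
  proof -
    have "(\<lambda>s. f (X (max 0 s) \<omega>)) \<in> borel_measurable borel"
      using measurable_compose[OF measurable_Pair1'[of \<omega> M borel] path] that by simp
    then have "(\<lambda>s. f (X (max 0 s) \<omega>) * indicator {t<..} s) \<in> borel_measurable borel"
      by measurable
    from nn_integral_real_affine[OF this, of 1 t]
    have "(\<integral>\<^sup>+s. f (X (max 0 s) \<omega>) * indicator {t<..} s \<partial>lborel)
      = (\<integral>\<^sup>+s. f (X (max 0 (t + s)) \<omega>) * indicator {t<..} (t + s) \<partial>lborel)" by simp
    also have "\<dots> = (\<integral>\<^sup>+s\<in>{0<..}. f (X (t + s) \<omega>) \<partial>lborel)"
      using t by (intro nn_integral_cong) (auto split: split_indicator)
    also have "(\<integral>\<^sup>+s. f (X (max 0 s) \<omega>) * indicator {t<..} s \<partial>lborel) = (\<integral>\<^sup>+s\<in>{t<..}. f (X s \<omega>) \<partial>lborel)"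
      using t by (intro nn_integral_cong) (auto split: split_indicator)
    finally show ?thesis .
  qed
  let ?K = "\<lambda>s y. distr (P y) borel (X (max 0 s))"
  have QK: "Q s y = ?K s y" if "0 < s" for s y
    using that by (simp add: transition[symmetric] max_def)
  have "(\<lambda>p. ?K (fst p) (snd p)) \<in> borel \<Otimes>\<^sub>M borel \<rightarrow>\<^sub>M subprob_algebra borel"
    using measurable_prob_algebraD[OF transition_jointly_measurable] by (simp add: split_beta')
  from measurable_compose[OF this nn_integral_measurable_subprob_algebra[OF f]]
  have K: "(\<lambda>p. \<integral>\<^sup>+z. f z \<partial>?K (fst p) (snd p)) \<in> borel_measurable (borel \<Otimes>\<^sub>M borel)" .
  have X': "(\<lambda>p. (snd p, X t (fst p))) \<in> M \<Otimes>\<^sub>M borel \<rightarrow>\<^sub>M borel \<Otimes>\<^sub>M borel"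
    by measurable
  have K': "(\<lambda>p. \<integral>\<^sup>+z. f z \<partial>?K (snd p) (X t (fst p))) \<in> borel_measurable (M \<Otimes>\<^sub>M borel)"
    using measurable_compose[OF X' K] by simp
  have "(\<integral>\<^sup>+\<omega>\<in>L. (\<integral>\<^sup>+s\<in>{t<..}. f (X s \<omega>) \<partial>lborel) \<partial>P x)
    = (\<integral>\<^sup>+\<omega>. (\<integral>\<^sup>+s. f (X (max 0 (t + s)) \<omega>) * indicator {0<..} s * indicator L \<omega> \<partial>lborel) \<partial>P x)"
  proof (intro nn_integral_cong)
    fix \<omega> assume "\<omega> \<in> space (P x)"
    then have \<omega>: "\<omega> \<in> space M" by simp
    have "(\<integral>\<^sup>+s. f (X (max 0 (t + s)) \<omega>) * indicator {0<..} s * indicator L \<omega> \<partial>lborel)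
      = (\<integral>\<^sup>+s. f (X (t + s) \<omega>) * indicator {0<..} s * indicator L \<omega> \<partial>lborel)"
      using t by (intro nn_integral_cong) (auto split: split_indicator)
    also have "\<dots> = (\<integral>\<^sup>+s\<in>{0<..}. f (X (t + s) \<omega>) \<partial>lborel) * indicator L \<omega>"
      by (auto split: split_indicator)
    finally show "(\<integral>\<^sup>+s\<in>{t<..}. f (X s \<omega>) \<partial>lborel) * indicator L \<omega>
      = (\<integral>\<^sup>+s. f (X (max 0 (t + s)) \<omega>) * indicator {0<..} s * indicator L \<omega> \<partial>lborel)"
      using shift[OF \<omega>] by simp
  qed
  also have "\<dots> = (\<integral>\<^sup>+s. (\<integral>\<^sup>+\<omega>. f (X (max 0 (t + s)) \<omega>) * indicator {0<..} s * indicator L \<omega> \<partial>P x) \<partial>lborel)"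
  proof (rule Fubini'[symmetric])
    have "(\<lambda>p. (fst p, t + snd p)) \<in> M \<Otimes>\<^sub>M borel \<rightarrow>\<^sub>M M \<Otimes>\<^sub>M borel" by measurable
    from measurable_compose[OF this path]
    have [measurable]: "(\<lambda>p. f (X (max 0 (t + snd p)) (fst p))) \<in> borel_measurable (M \<Otimes>\<^sub>M borel)" by simp
    have "(\<lambda>p. f (X (max 0 (t + snd p)) (fst p)) * indicator {0<..} (snd p) * indicator L (fst p))
      \<in> borel_measurable (M \<Otimes>\<^sub>M borel)" by measurable
    then show "(\<lambda>(\<omega>, s). f (X (max 0 (t + s)) \<omega>) * indicator {0<..} s * indicator L \<omega>)
      \<in> borel_measurable (P x \<Otimes>\<^sub>M lborel)"
      by (simp add: split_beta' measurable_cong_sets[OF sets_pair refl])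
  qed
  also have "\<dots> = (\<integral>\<^sup>+s. (\<integral>\<^sup>+\<omega>. (\<integral>\<^sup>+z. f z \<partial>?K s (X t \<omega>)) * indicator {0<..} s * indicator L \<omega> \<partial>P x) \<partial>lborel)"
  proof (rule nn_integral_cong)
    fix s :: real
    show "(\<integral>\<^sup>+\<omega>. f (X (max 0 (t + s)) \<omega>) * indicator {0<..} s * indicator L \<omega> \<partial>P x)
      = (\<integral>\<^sup>+\<omega>. (\<integral>\<^sup>+z. f z \<partial>?K s (X t \<omega>)) * indicator {0<..} s * indicator L \<omega> \<partial>P x)"
    proof (cases "0 < s")
      case True
      then show ?thesis
        using markov_property[OF t True L f, of x] t by (simp add: QK[OF True] max_def)
    qed simp
  qed
  also have "\<dots> = (\<integral>\<^sup>+\<omega>. (\<integral>\<^sup>+s. (\<integral>\<^sup>+z. f z \<partial>?K s (X t \<omega>)) * indicator {0<..} s * indicator L \<omega> \<partial>lborel) \<partial>P x)"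
  proof (rule Fubini')
    note K' [measurable]
    have "(\<lambda>p. (\<integral>\<^sup>+z. f z \<partial>?K (snd p) (X t (fst p))) * indicator {0<..} (snd p) * indicator L (fst p))
      \<in> borel_measurable (M \<Otimes>\<^sub>M borel)" by measurable
    then show "(\<lambda>(\<omega>, s). (\<integral>\<^sup>+z. f z \<partial>?K s (X t \<omega>)) * indicator {0<..} s * indicator L \<omega>)
      \<in> borel_measurable (P x \<Otimes>\<^sub>M lborel)"
      by (simp add: split_beta' measurable_cong_sets[OF sets_pair refl])
  qed
  also have "\<dots> = (\<integral>\<^sup>+\<omega>\<in>L. potential_kernel Q f (X t \<omega>) \<partial>P x)"
  proof (intro nn_integral_cong)
    fix \<omega>
    have "(\<integral>\<^sup>+s. (\<integral>\<^sup>+z. f z \<partial>?K s (X t \<omega>)) * indicator {0<..} s * indicator L \<omega> \<partial>lborel)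
      = (\<integral>\<^sup>+s. (\<integral>\<^sup>+z. f z \<partial>Q s (X t \<omega>)) * indicator {0<..} s * indicator L \<omega> \<partial>lborel)"
      by (intro nn_integral_cong) (auto split: split_indicator simp: QK)
    also have "\<dots> = potential_kernel Q f (X t \<omega>) * indicator L \<omega>"
      unfolding potential_kernel_def by (auto split: split_indicator)
    finally show "(\<integral>\<^sup>+s. (\<integral>\<^sup>+z. f z \<partial>?K s (X t \<omega>)) * indicator {0<..} s * indicator L \<omega> \<partial>lborel)
      = potential_kernel Q f (X t \<omega>) * indicator L \<omega>" .
  qed
  finally show ?thesis .
qed

lemma path_near:
  assumes "open A" "0 \<le> t" "\<omega> \<in> space M" "X t \<omega> \<in> A"
  obtains e where "0 < e" "\<And>s. t \<le> s \<Longrightarrow> s < t + e \<Longrightarrow> X s \<omega> \<in> A"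
proof -
  have "\<forall>\<^sub>F s in at_right t. X s \<omega> \<in> A"
    using path_right_continuous[OF assms(2,3)] assms(1,4) by (rule topological_tendstoD)
  then obtain b where "t < b" "\<And>s. t < s \<Longrightarrow> s < b \<Longrightarrow> X s \<omega> \<in> A"
    by (auto simp: eventually_at_right_field)
  then show ?thesis
    using assms(4) by (intro that[of "b - t"]) (auto simp: le_less)
qed

definition hits :: "'v set \<Rightarrow> 'w set" where
  "hits A = {\<omega> \<in> space M. \<exists>s\<ge>0. X s \<omega> \<in> A}"

text \<open>A path that is in an open set stays there for a short while, so rational times suffice. In
  particular hitting an open set is an event, without completion.\<close>

lemma hits_eq_rational:
  assumes "open A"
  shows "hits A = (\<Union>q\<in>{q\<in>\<rat>. 0 \<le> q}. {\<omega> \<in> space M. X q \<omega> \<in> A})"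
proof (intro set_eqI iffI)
  fix \<omega> assume "\<omega> \<in> hits A"
  then obtain s where s: "0 \<le> s" "\<omega> \<in> space M" "X s \<omega> \<in> A" by (auto simp: hits_def)
  obtain e where e: "0 < e" "\<And>u. s \<le> u \<Longrightarrow> u < s + e \<Longrightarrow> X u \<omega> \<in> A"
    using path_near[OF assms s] by blast
  obtain q where "q \<in> \<rat>" "s < q" "q < s + e" using Rats_dense_in_real[of s "s + e"] e(1) by auto
  then show "\<omega> \<in> (\<Union>q\<in>{q\<in>\<rat>. 0 \<le> q}. {\<omega> \<in> space M. X q \<omega> \<in> A})"
    using e(2)[of q] s by (intro UN_I[of q]) auto
qed (auto simp: hits_def)

lemma hits_measurable:
  assumes "open A"
  shows "hits A \<in> sets M"
  unfolding hits_eq_rational[OF assms]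
proof (intro sets.countable_UN'')
  show "countable {q \<in> \<rat>. 0 \<le> (q::real)}"
    by (rule countable_subset[OF _ countable_rat]) auto
  fix q :: real assume "q \<in> {q \<in> \<rat>. 0 \<le> q}"
  then show "{\<omega> \<in> space M. X q \<omega> \<in> A} \<in> sets M"
    using measurable_sets[OF X_measurable[of q] borel_open[OF assms]]
    by (simp add: vimage_def Int_def conj_commute)
qed

text \<open>The first entrance time into \<open>A\<close> is replaced by the first entrance \<open>T n k\<close> along a grid of mesh
  \<open>1 / (n + 1)\<close> that starts at \<open>t\<close>; the events \<open>E n k\<close> say that \<open>k\<close> is the first index with
  \<open>X (T n k) \<in> A\<close>, so that the Markov property at fixed times suffices. What is lost between the true
  entrance and the grid entrance disappears in the limit \<open>n \<rightarrow> \<infinity>\<close>, by Fatou's lemma.\<close>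

lemma potential_le_hitting:
  assumes t: "0 \<le> t" and L: "L \<in> sets (F (ennreal t))" and f: "f \<in> borel_measurable borel"
    and A: "open A" and supp: "\<And>y. y \<notin> A \<Longrightarrow> f y = 0" and bound: "\<And>y. potential_kernel Q f y \<le> c"
  shows "(\<integral>\<^sup>+\<omega>\<in>L. potential_kernel Q f (X t \<omega>) \<partial>P x) \<le> c * emeasure (P x) (L \<inter> hits A)"
proof -
  note f [measurable]
  have LM [measurable]: "L \<in> sets M" and A' [measurable]: "A \<in> sets borel" using L F_le A by auto
  have HM [measurable]: "hits A \<in> sets M" using A by (rule hits_measurable)
  have path [measurable]: "(\<lambda>p. f (X (max 0 (snd p)) (fst p))) \<in> borel_measurable (M \<Otimes>\<^sub>M borel)"
    using measurable_compose[OF paths_jointly_measurable f] by (simp add: split_beta')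
  have path_section: "(\<lambda>s. f (X (max 0 s) \<omega>)) \<in> borel_measurable borel" if "\<omega> \<in> space M" for \<omega>
    using measurable_compose[OF measurable_Pair1'[of \<omega> M borel] path] that by simp
  define T where "T n k = t + real k / real (Suc n)" for n k
  have T_nonneg: "0 \<le> T n k" and T_ge: "t \<le> T n k" for n k
    using t by (auto simp: T_def)
  have T_mono: "T n j \<le> T n k" if "j \<le> k" for n j k
    using that by (auto simp: T_def divide_right_mono)
  define E where "E n k = {\<omega> \<in> L. (\<forall>j<k. X (T n j) \<omega> \<notin> A) \<and> X (T n k) \<omega> \<in> A}" for n k
  have E_F: "E n k \<in> sets (F (ennreal (T n k)))" for n k
  proof -
    have "L \<in> sets (F (ennreal (T n k)))"
      using L sets_F_mono[of "ennreal t" "ennreal (T n k)"] T_ge[of n k] by (auto simp: ennreal_leI)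
    moreover have "X (T n j) \<in> borel_measurable (F (ennreal (T n k)))" if "j \<le> k" for j
      using that by (intro X_adapted_mono T_nonneg T_mono)
    then have "{\<omega> \<in> space (F (ennreal (T n k))). (\<forall>j\<in>{..<k}. X (T n j) \<omega> \<notin> A) \<and> X (T n k) \<omega> \<in> A}
        \<in> sets (F (ennreal (T n k)))"
      by measurable
    ultimately have "L \<inter> {\<omega> \<in> space (F (ennreal (T n k))). (\<forall>j\<in>{..<k}. X (T n j) \<omega> \<notin> A) \<and> X (T n k) \<omega> \<in> A}
        \<in> sets (F (ennreal (T n k)))"
      by (rule sets.Int)
    moreover have "L \<subseteq> space M"
      using sets.sets_into_space[OF LM] .
    then have "E n k = L \<inter> {\<omega> \<in> space (F (ennreal (T n k))). (\<forall>j\<in>{..<k}. X (T n j) \<omega> \<notin> A) \<and> X (T n k) \<omega> \<in> A}"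
      unfolding space_F by (auto simp: E_def)
    ultimately show ?thesis by simp
  qed
  have EM [measurable]: "E n k \<in> sets M" for n k using E_F F_le by blast
  have disj: "disjoint_family (E n)" for n
    unfolding disjoint_family_on_def E_def by (auto, metis nat_neq_iff)
  have E_sub: "(\<Union>k. E n k) \<subseteq> L \<inter> hits A" for n
    using T_nonneg sets.sets_into_space[OF LM] by (auto simp: E_def hits_def)
  define I where "I n \<omega> = (\<Sum>k. (\<integral>\<^sup>+s\<in>{T n k<..}. f (X s \<omega>) \<partial>lborel) * indicator (E n k) \<omega>)" for n \<omega>
  have after_measurable: "(\<lambda>\<omega>. \<integral>\<^sup>+s\<in>{u<..}. f (X s \<omega>) \<partial>lborel) \<in> borel_measurable M" if "0 \<le> u" for u
  proof -
    have "(\<lambda>(\<omega>, s). f (X (max 0 s) \<omega>) * indicator {u<..} s) \<in> borel_measurable (M \<Otimes>\<^sub>M lborel)"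
      unfolding split_beta' by measurable
    then have "(\<lambda>\<omega>. \<integral>\<^sup>+s. f (X (max 0 s) \<omega>) * indicator {u<..} s \<partial>lborel) \<in> borel_measurable M"
      by (rule lborel.borel_measurable_nn_integral)
    also have "(\<lambda>\<omega>. \<integral>\<^sup>+s. f (X (max 0 s) \<omega>) * indicator {u<..} s \<partial>lborel) = (\<lambda>\<omega>. \<integral>\<^sup>+s\<in>{u<..}. f (X s \<omega>) \<partial>lborel)"
      using that by (intro ext nn_integral_cong) (auto split: split_indicator)
    finally show ?thesis .
  qed
  have I_M [measurable]: "I n \<in> borel_measurable M" for n
    unfolding I_def using after_measurable[OF T_nonneg] by measurable
  have I_bound: "(\<integral>\<^sup>+\<omega>. I n \<omega> \<partial>P x) \<le> c * emeasure (P x) (L \<inter> hits A)" for n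
  proof -
    have "(\<integral>\<^sup>+\<omega>. I n \<omega> \<partial>P x) = (\<Sum>k. \<integral>\<^sup>+\<omega>\<in>E n k. (\<integral>\<^sup>+s\<in>{T n k<..}. f (X s \<omega>) \<partial>lborel) \<partial>P x)"
      unfolding I_def using after_measurable[OF T_nonneg] by (intro nn_integral_suminf) (simp add: sets_P)
    also have "\<dots> = (\<Sum>k. \<integral>\<^sup>+\<omega>\<in>E n k. potential_kernel Q f (X (T n k) \<omega>) \<partial>P x)"
      by (simp add: markov_property_potential[OF T_nonneg E_F f])
    also have "\<dots> \<le> (\<Sum>k. \<integral>\<^sup>+\<omega>\<in>E n k. c \<partial>P x)"
      by (intro suminf_le nn_integral_mono mult_right_mono bound) auto
    also have "\<dots> = (\<Sum>k. c * emeasure (P x) (E n k))"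
      by (simp add: nn_integral_cmult_indicator sets_P)
    also have "\<dots> = c * emeasure (P x) (\<Union>k. E n k)"
      by (subst ennreal_suminf_cmult, subst suminf_emeasure) (auto simp: disj sets_P)
    also have "\<dots> \<le> c * emeasure (P x) (L \<inter> hits A)"
      by (intro mult_left_mono emeasure_mono E_sub) (simp_all add: sets_P)
    finally show ?thesis .
  qed
  have pathwise: "(\<integral>\<^sup>+s\<in>{t<..}. f (X s \<omega>) \<partial>lborel) \<le> liminf (\<lambda>n. I n \<omega>)" if \<omega>: "\<omega> \<in> L" for \<omega>
  proof -
    have \<omega>M: "\<omega> \<in> space M" using \<omega> sets.sets_into_space[OF LM] by blast
    define \<phi> where "\<phi> n s = (\<Sum>k. f (X (max 0 s) \<omega>) * indicator {T n k<..} s * indicator (E n k) \<omega>)" for n s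
    have [measurable]: "\<phi> n \<in> borel_measurable borel" for n
      unfolding \<phi>_def using path_section[OF \<omega>M] by measurable
    have int_\<phi>: "(\<integral>\<^sup>+s. \<phi> n s \<partial>lborel) = I n \<omega>" for n
    proof -
      have piece: "(\<integral>\<^sup>+s. f (X (max 0 s) \<omega>) * indicator {T n k<..} s * indicator (E n k) \<omega> \<partial>lborel)
        = (\<integral>\<^sup>+s\<in>{T n k<..}. f (X s \<omega>) \<partial>lborel) * indicator (E n k) \<omega>" for k
      proof -
        have "(\<integral>\<^sup>+s. f (X (max 0 s) \<omega>) * indicator {T n k<..} s * indicator (E n k) \<omega> \<partial>lborel)
          = (\<integral>\<^sup>+s. f (X s \<omega>) * indicator {T n k<..} s * indicator (E n k) \<omega> \<partial>lborel)"
          using T_nonneg[of n k] by (intro nn_integral_cong) (auto split: split_indicator)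
        then show ?thesis by (auto split: split_indicator)
      qed
      have "(\<integral>\<^sup>+s. \<phi> n s \<partial>lborel) = (\<Sum>k. \<integral>\<^sup>+s. f (X (max 0 s) \<omega>) * indicator {T n k<..} s * indicator (E n k) \<omega> \<partial>lborel)"
        unfolding \<phi>_def using path_section[OF \<omega>M] by (intro nn_integral_suminf) simp
      also have "\<dots> = I n \<omega>" by (simp only: I_def piece)
      finally show ?thesis .
    qed
    have ev: "\<forall>\<^sub>F n in sequentially. f (X s \<omega>) \<le> \<phi> n s" if s: "t \<le> s'" "s' < s" "X s' \<omega> \<in> A" for s s'
    proof -
      have s'0: "0 \<le> s'" using t s by simp
      obtain e where e: "0 < e" "\<And>u. s' \<le> u \<Longrightarrow> u < s' + e \<Longrightarrow> X u \<omega> \<in> A"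
        using path_near[OF A s'0 \<omega>M s(3)] by blast
      have "\<forall>\<^sub>F n in sequentially. 1 / real (Suc n) < min e (s - s')"
        using e(1) s by (intro order_tendstoD(2)[OF LIMSEQ_Suc[OF lim_1_over_n]]) auto
      then show ?thesis
      proof eventually_elim
        case (elim n)
        have "0 \<le> s' - t" using s by simp
        from grid_above_bounds[OF this, of n]
        obtain k where k: "s' < T n k" "T n k \<le> s' + 1 / real (Suc n)"
          unfolding grid_above_def T_def by (smt (verit))
        then have "X (T n k) \<omega> \<in> A" using elim by (intro e(2)) auto
        define j where "j = (LEAST j. X (T n j) \<omega> \<in> A)"
        have j: "X (T n j) \<omega> \<in> A" "j \<le> k" "\<forall>i<j. X (T n i) \<omega> \<notin> A"
          unfolding j_def using \<open>X (T n k) \<omega> \<in> A\<close> by (auto intro: LeastI Least_le dest: not_less_Least)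
        have "T n j < s" using T_mono[OF j(2), of n] k elim by auto
        moreover have "\<omega> \<in> E n j" using j \<omega> by (auto simp: E_def)
        moreover have "0 \<le> s" using s s'0 by simp
        ultimately have "f (X s \<omega>) = f (X (max 0 s) \<omega>) * indicator {T n j<..} s * indicator (E n j) \<omega>"
          by simp
        also have "\<dots> = (\<Sum>k\<in>{j}. f (X (max 0 s) \<omega>) * indicator {T n k<..} s * indicator (E n k) \<omega>)"
          by (simp only: sum.insert sum.empty finite.emptyI empty_iff not_False_eq_True add_0_right)
        also have "\<dots> \<le> \<phi> n s"
          unfolding \<phi>_def by (intro sum_le_suminf) auto
        finally show ?case .
      qed
    qed
    \<comment> \<open>Only at the very first time in \<open>A\<close> can a path be in \<open>A\<close> with no earlier grid entrance for large \<open>n\<close>.\<close>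
    define N where "N = {s. t < s \<and> X s \<omega> \<in> A \<and> (\<forall>s'. t \<le> s' \<and> s' < s \<longrightarrow> X s' \<omega> \<notin> A)}"
    have "N \<subseteq> {s0}" if "s0 \<in> N" for s0
      using that unfolding N_def by (auto, metis less_imp_le linorder_neqE_linordered_idom)
    then have "countable N" by (metis countable_empty countable_insert countable_subset ex_in_conv)
    then have "AE s in lborel. s \<notin> N"
      by (intro AE_not_in null_setsI emeasure_lborel_countable) (auto simp: sets.countable)
    then have "AE s in lborel. f (X s \<omega>) * indicator {t<..} s \<le> liminf (\<lambda>n. \<phi> n s)"
    proof eventually_elim
      case (elim s)
      show ?case
      proof (cases "t < s \<and> X s \<omega> \<in> A")
        case True
        then obtain s' where "t \<le> s'" "s' < s" "X s' \<omega> \<in> A" using elim by (auto simp: N_def)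
        from ev[OF this] show ?thesis using True by (simp add: Liminf_bounded)
      next
        case False
        then show ?thesis using supp by (auto split: split_indicator)
      qed
    qed
    then have "(\<integral>\<^sup>+s\<in>{t<..}. f (X s \<omega>) \<partial>lborel) \<le> (\<integral>\<^sup>+s. liminf (\<lambda>n. \<phi> n s) \<partial>lborel)"
      by (rule nn_integral_mono_AE)
    also have "\<dots> \<le> liminf (\<lambda>n. \<integral>\<^sup>+s. \<phi> n s \<partial>lborel)"
      by (intro nn_integral_liminf) simp
    finally show ?thesis by (simp add: int_\<phi>)
  qed
  have "(\<integral>\<^sup>+\<omega>\<in>L. potential_kernel Q f (X t \<omega>) \<partial>P x) = (\<integral>\<^sup>+\<omega>\<in>L. (\<integral>\<^sup>+s\<in>{t<..}. f (X s \<omega>) \<partial>lborel) \<partial>P x)"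
    by (rule markov_property_potential[OF t L f, symmetric])
  also have "\<dots> \<le> (\<integral>\<^sup>+\<omega>. liminf (\<lambda>n. I n \<omega>) \<partial>P x)"
    by (intro nn_integral_mono) (auto split: split_indicator intro: pathwise)
  also have "\<dots> \<le> liminf (\<lambda>n. \<integral>\<^sup>+\<omega>. I n \<omega> \<partial>P x)"
    by (intro nn_integral_liminf) simp
  also have "\<dots> \<le> liminf (\<lambda>n. c * emeasure (P x) (L \<inter> hits A))"
    by (intro Liminf_mono always_eventually allI I_bound)
  also have "\<dots> = c * emeasure (P x) (L \<inter> hits A)"
    by (simp add: Liminf_const)
  finally show ?thesis .
qed

text \<open>From any moment on, whatever the past, \<open>A\<close> is hit with conditional probability at least \<open>\<delta>\<close>; so it
  cannot be avoided forever with positive probability. The constant \<open>\<delta>\<close> must not depend on \<open>N\<close>, whereas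
  \<open>f\<close> and \<open>c\<close> may: they are chosen after the position at the given moment is confined to a ball.\<close>

lemma unavoidable_if_potentials:
  assumes A: "open A" and \<delta>: "0 < \<delta>"
    and pot: "\<And>N. \<exists>f c. f \<in> borel_measurable borel \<and> (\<forall>y. y \<notin> A \<longrightarrow> f y = 0) \<and> 0 < c \<and>
      (\<forall>y. potential_kernel Q f y \<le> ennreal c) \<and> (\<forall>y. norm y \<le> N \<longrightarrow> ennreal (\<delta> * c) \<le> potential_kernel Q f y)"
  shows "unavoidable X P A"
proof -
  have A' [measurable]: "A \<in> sets borel" using A by simp
  have HM [measurable]: "hits A \<in> sets M" using A by (rule hits_measurable)
  have "measure (P x) (hits A) = 1" for x
  proof -
    interpret prob_space "P x" by (rule prob)
    have local: "\<delta> * prob {\<omega> \<in> L. norm (X t \<omega>) \<le> N} \<le> prob (L \<inter> hits A)"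
      if t: "0 \<le> t" and L: "L \<in> sets (F (ennreal t))" for t L N
    proof -
      obtain f c where f: "f \<in> borel_measurable borel" "\<And>y. y \<notin> A \<Longrightarrow> f y = 0" and c: "0 < c"
        and upper: "\<And>y. potential_kernel Q f y \<le> ennreal c"
        and lower: "\<And>y. norm y \<le> N \<Longrightarrow> ennreal (\<delta> * c) \<le> potential_kernel Q f y"
        using pot[of N] by blast
      have LM [measurable]: "L \<in> sets M" using L F_le by auto
      have [measurable]: "X t \<in> borel_measurable M" using t by (rule X_measurable)
      have eq: "{\<omega> \<in> L. norm (X t \<omega>) \<le> N} = L \<inter> {\<omega> \<in> space M. norm (X t \<omega>) \<le> N}"
        using sets.sets_into_space[OF LM] by auto
      have sets: "{\<omega> \<in> L. norm (X t \<omega>) \<le> N} \<in> sets M" unfolding eq by measurable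
      have "ennreal (\<delta> * c) * emeasure (P x) {\<omega> \<in> L. norm (X t \<omega>) \<le> N}
        = (\<integral>\<^sup>+\<omega>\<in>{\<omega> \<in> L. norm (X t \<omega>) \<le> N}. ennreal (\<delta> * c) \<partial>P x)"
        using sets by (simp add: nn_integral_cmult_indicator sets_P)
      also have "\<dots> \<le> (\<integral>\<^sup>+\<omega>\<in>L. potential_kernel Q f (X t \<omega>) \<partial>P x)"
        by (intro nn_integral_mono) (auto split: split_indicator intro: lower)
      also have "\<dots> \<le> ennreal c * emeasure (P x) (L \<inter> hits A)"
        using t L f(1) A f(2) upper by (rule potential_le_hitting)
      finally have "\<delta> * c * prob {\<omega> \<in> L. norm (X t \<omega>) \<le> N} \<le> c * prob (L \<inter> hits A)"
        using c \<delta> by (simp add: emeasure_eq_measure ennreal_mult'[symmetric] measure_nonneg)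
      then show ?thesis using c by (simp add: mult.assoc mult.left_commute[of \<delta>])
    qed
    \<comment> \<open>The bound on the position is removed by letting \<open>N \<rightarrow> \<infinity>\<close>.\<close>
    have local': "\<delta> * prob L \<le> prob (L \<inter> hits A)" if t: "0 \<le> t" and L: "L \<in> sets (F (ennreal t))" for t L
    proof -
      have LM [measurable]: "L \<in> sets M" using L F_le by auto
      have [measurable]: "X t \<in> borel_measurable M" using t by (rule X_measurable)
      have eq: "{\<omega> \<in> L. norm (X t \<omega>) \<le> N} = L \<inter> {\<omega> \<in> space M. norm (X t \<omega>) \<le> N}" for N
        using sets.sets_into_space[OF LM] by auto
      have sets: "{\<omega> \<in> L. norm (X t \<omega>) \<le> N} \<in> sets M" for N unfolding eq by measurable
      have "(\<lambda>n. prob {\<omega> \<in> L. norm (X t \<omega>) \<le> real n}) \<longlonglongrightarrow> prob (\<Union>n. {\<omega> \<in> L. norm (X t \<omega>) \<le> real n})"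
        by (rule finite_Lim_measure_incseq) (use sets in \<open>auto simp: incseq_def sets_P\<close>)
      also have "(\<Union>n. {\<omega> \<in> L. norm (X t \<omega>) \<le> real n}) = L"
        by (auto intro: real_arch_simple)
      finally have "(\<lambda>n. \<delta> * prob {\<omega> \<in> L. norm (X t \<omega>) \<le> real n}) \<longlonglongrightarrow> \<delta> * prob L"
        by (intro tendsto_intros)
      then show ?thesis by (rule LIMSEQ_le_const2) (auto intro: local[OF t L])
    qed
    define L where "L n = {\<omega> \<in> space M. \<forall>q\<in>{q\<in>\<rat>. 0 \<le> q \<and> q \<le> real n}. X q \<omega> \<notin> A}" for n
    have L_F: "L n \<in> sets (F (ennreal (real n)))" for n
    proof -
      have "countable {q \<in> \<rat>. 0 \<le> q \<and> q \<le> real n}"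
        by (rule countable_subset[OF _ countable_rat]) auto
      moreover have "X q \<in> borel_measurable (F (ennreal (real n)))" if "q \<in> {q\<in>\<rat>. 0 \<le> q \<and> q \<le> real n}" for q
        using that by (intro X_adapted_mono) auto
      ultimately have "{\<omega> \<in> space (F (ennreal (real n))). \<forall>q\<in>{q\<in>\<rat>. 0 \<le> q \<and> q \<le> real n}. X q \<omega> \<notin> A} \<in> sets (F (ennreal (real n)))"
        by (intro sets.sets_Collect_countable_All') measurable
      then show ?thesis by (simp add: L_def space_F)
    qed
    have LM: "L n \<in> sets M" for n using L_F F_le by blast
    have "decseq L" by (auto simp: decseq_def L_def)
    have inter: "(\<Inter>n. L n) = space M - hits A"
    proof (intro equalityI subsetI)
      fix \<omega> assume \<omega>: "\<omega> \<in> (\<Inter>n. L n)"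
      have "X q \<omega> \<notin> A" if "q \<in> \<rat>" "0 \<le> q" for q
      proof -
        obtain n where "q \<le> real n" using real_arch_simple by blast
        then show ?thesis using \<omega> that by (auto simp: L_def)
      qed
      then show "\<omega> \<in> space M - hits A"
        using \<omega> unfolding hits_eq_rational[OF A] by (auto simp: L_def)
    qed (auto simp: L_def hits_def)
    have lim1: "(\<lambda>n. prob (L n)) \<longlonglongrightarrow> prob (\<Inter>n. L n)"
      using \<open>decseq L\<close> LM by (intro finite_Lim_measure_decseq) (auto simp: sets_P)
    have lim2: "(\<lambda>n. prob (L n \<inter> hits A)) \<longlonglongrightarrow> prob (\<Inter>n. L n \<inter> hits A)"
      using \<open>decseq L\<close> LM by (intro finite_Lim_measure_decseq) (auto simp: sets_P decseq_def)
    have "(\<Inter>n. L n \<inter> hits A) = {}" using inter by auto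
    then have "\<delta> * prob (\<Inter>n. L n) \<le> 0"
      using tendsto_mult_left[OF lim1, of \<delta>] lim2 by (intro LIMSEQ_le) (auto intro!: exI[of _ 0] local'[OF _ L_F])
    then have "prob (space M - hits A) = 0"
      using \<delta> inter measure_nonneg[of "P x" "\<Inter>n. L n"] by (simp add: mult_le_0_iff order_antisym)
    then show ?thesis using prob_compl[of "hits A"] by (simp add: sets_P)
  qed
  moreover have "{\<omega> \<in> space (P x). hitting_time X A \<omega> < \<infinity>} = hits A" for x
    by (auto simp: hits_def hitting_time_def INF_less_iff)
  ultimately show ?thesis
    unfolding unavoidable_def using prob
    by (simp add: sets_P finite_measure.emeasure_eq_measure prob_space_def)
qed

end

section \<open>Potentials of balls under the lower doubling condition\<close>

lemma ball_in_sets_borel [measurable]: "ball (z::'v::euclidean_space) r \<in> sets borel"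
  by simp

text \<open>Integration in polar coordinates: the image of Lebesgue measure on the ball under the distance to \<open>y\<close> is
  identified by its values on the half-lines \<open>{x<..}\<close>, that is, by the volumes of balls.\<close>

lemma nn_integral_ball_radial:
  fixes y :: "'v::euclidean_space" and h :: "real \<Rightarrow> ennreal"
  assumes h [measurable]: "h \<in> borel_measurable borel" and r: "0 < r"
  shows "(\<integral>\<^sup>+u\<in>ball y r. h (norm (y - u)) \<partial>lborel) =
    ennreal (unit_ball_vol (DIM('v))) * (of_nat DIM('v) * (\<integral>\<^sup>+s\<in>{0<..<r}. ennreal (s ^ (DIM('v) - 1)) * h s \<partial>lborel))"
proof -
  let ?d = "DIM('v)"
  define W where "W = unit_ball_vol (real ?d)"
  have W: "0 \<le> W" by (simp add: W_def)
  define N1 where "N1 = distr (density lborel (indicator (ball y r))) borel (\<lambda>u::'v. norm (y - u))"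
  define N2 where "N2 = density lborel (\<lambda>s::real. ennreal (W * (real ?d * s ^ (?d - 1))) * indicator {0<..<r} s)"
  have N1: "emeasure N1 {x<..} = (if x < r then ennreal (W * r ^ ?d - W * max 0 x ^ ?d) else 0)" for x
  proof -
    have "emeasure N1 {x<..} = emeasure (density lborel (indicator (ball y r))) {u. x < norm (y - u)}"
      unfolding N1_def by (subst emeasure_distr) (auto simp: vimage_def)
    also have "\<dots> = (\<integral>\<^sup>+u. indicator (ball y r) u * indicator {u. x < norm (y - u)} u \<partial>lborel)"
      by (subst emeasure_density) auto
    also have "\<dots> = (\<integral>\<^sup>+u. indicator (ball y r \<inter> {u. x < norm (y - u)}) u \<partial>lborel)"
      by (simp add: indicator_inter_arith)
    also have "\<dots> = emeasure lborel (ball y r \<inter> {u. x < norm (y - u)})"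
      by (subst nn_integral_indicator) auto
    also have "\<dots> = (if x < r then ennreal (W * r ^ ?d - W * max 0 x ^ ?d) else 0)"
    proof -
      consider "x < 0" | "0 \<le> x" "x < r" | "r \<le> x" by linarith
      then show ?thesis
      proof cases
        case 1
        then have "x < norm v" for v :: 'v using norm_ge_zero[of v] by linarith
        then have "ball y r \<inter> {u. x < norm (y - u)} = ball y r" by auto
        then show ?thesis using 1 r by (simp add: emeasure_ball W_def)
      next
        case 2
        have "ball y r \<inter> {u. x < norm (y - u)} = ball y r - cball y x"
          by (auto simp: dist_norm)
        also have "emeasure lborel \<dots> = emeasure lborel (ball y r) - emeasure lborel (cball y x)"
          using 2 by (intro emeasure_Diff) (auto simp: emeasure_cball)
        also have "\<dots> = ennreal (W * r ^ ?d) - ennreal (W * x ^ ?d)"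
          using 2 r by (simp add: emeasure_ball emeasure_cball W_def)
        also have "\<dots> = ennreal (W * r ^ ?d - W * x ^ ?d)"
          using 2 W by (intro ennreal_minus) simp
        finally show ?thesis using 2 by (simp add: max_def)
      next
        case 3
        then have "ball y r \<inter> {u. x < norm (y - u)} = {}" by (auto simp: dist_norm)
        then show ?thesis using 3 by simp
      qed
    qed
    finally show ?thesis .
  qed
  have N2: "emeasure N2 {x<..} = (if x < r then ennreal (W * r ^ ?d - W * max 0 x ^ ?d) else 0)" for x
  proof (cases "x < r")
    case True
    have "emeasure N2 {x<..} = (\<integral>\<^sup>+s. ennreal (W * (real ?d * s ^ (?d - 1))) * indicator {0<..<r} s * indicator {x<..} s \<partial>lborel)"
      unfolding N2_def by (subst emeasure_density) auto
    also have "\<dots> = (\<integral>\<^sup>+s. ennreal (W * (real ?d * s ^ (?d - 1))) * indicator {max 0 x..r} s \<partial>lborel)"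
    proof (rule nn_integral_cong_AE)
      have "AE s in lborel. s \<noteq> max 0 x" "AE s in lborel. s \<noteq> r"
        by (rule AE_lborel_singleton)+
      then show "AE s in lborel. ennreal (W * (real ?d * s ^ (?d - 1))) * indicator {0<..<r} s * indicator {x<..} s
          = ennreal (W * (real ?d * s ^ (?d - 1))) * indicator {max 0 x..r} s"
        by eventually_elim (auto split: split_indicator)
    qed
    also have "\<dots> = ennreal (W * r ^ ?d - W * max 0 x ^ ?d)"
      using True r W
      by (intro nn_integral_FTC_Icc) (auto intro!: derivative_eq_intros)
    finally show ?thesis using True by simp
  next
    case False
    then have "(\<integral>\<^sup>+s. ennreal (W * (real ?d * s ^ (?d - 1))) * indicator {0<..<r} s * indicator {x<..} s \<partial>lborel) = (\<integral>\<^sup>+s. 0 \<partial>(lborel :: real measure))"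
      by (intro nn_integral_cong) (auto split: split_indicator)
    then show ?thesis
      using False unfolding N2_def by (subst emeasure_density) auto
  qed
  have "N1 = N2"
    by (rule measure_eqI_lessThan) (simp_all add: N1 N2 N1_def[THEN arg_cong[of _ _ sets]] N2_def[THEN arg_cong[of _ _ sets]])
  have "(\<integral>\<^sup>+u\<in>ball y r. h (norm (y - u)) \<partial>lborel) = (\<integral>\<^sup>+s. h s \<partial>N1)"
    unfolding N1_def by (subst nn_integral_distr) (auto simp: nn_integral_density mult.commute)
  also have "\<dots> = (\<integral>\<^sup>+s. ennreal W * (of_nat ?d * (ennreal (s ^ (?d - 1)) * h s * indicator {0<..<r} s)) \<partial>lborel)"
    unfolding \<open>N1 = N2\<close> N2_def
    by (subst nn_integral_density)
       (auto intro!: nn_integral_cong split: split_indicator simp: W ennreal_mult ennreal_of_nat_eq_real_of_nat mult_ac)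
  also have "\<dots> = ennreal W * (of_nat ?d * (\<integral>\<^sup>+s\<in>{0<..<r}. ennreal (s ^ (?d - 1)) * h s \<partial>lborel))"
    by (simp add: nn_integral_cmult)
  finally show ?thesis by (simp add: W_def)
qed

context isotropic_potential
begin

text \<open>The finite values \<open>g r\<close>, \<open>r > 0\<close>, as real numbers; at 0 the real-valued function has no meaning.\<close>

definition G :: "real \<Rightarrow> real" where "G r = enn2real (g r)"

definition vol :: real where "vol = unit_ball_vol DIM('v)"

definition C_LD :: real where
  "C_LD = (SOME C. 1 \<le> C \<and> (\<forall>r>R0.
      of_nat DIM('v) * (\<integral>\<^sup>+s\<in>{0<..<r}. ennreal (s ^ (DIM('v) - 1)) * g s \<partial>lborel)
        \<le> ennreal (C * r ^ DIM('v)) * g r))"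

definition C_dbl :: real where "C_dbl = 2 ^ DIM('v) * C_LD"

lemma vol_pos: "0 < vol" by (simp add: vol_def)

lemma C_LD: "1 \<le> C_LD"
  "R0 < r \<Longrightarrow> of_nat DIM('v) * (\<integral>\<^sup>+s\<in>{0<..<r}. ennreal (s ^ (DIM('v) - 1)) * g s \<partial>lborel)
        \<le> ennreal (C_LD * r ^ DIM('v)) * g r"
  using someI_ex[OF LD] unfolding C_LD_def[symmetric] by auto

lemma C_dbl_ge_1: "1 \<le> C_dbl"
  unfolding C_dbl_def using C_LD(1) mult_mono[of 1 "2 ^ DIM('v)" 1 C_LD] by simp

lemma g_eq: "0 < r \<Longrightarrow> g r = ennreal (G r)"
  using g_pos_finite[of r] by (simp add: G_def)

lemma G_pos: "0 < r \<Longrightarrow> 0 < G r"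
  using g_pos_finite[of r] g_eq[of r] by (metis ennreal_eq_0_iff not_le order_less_irrefl)

lemma g_antimono: "0 \<le> r \<Longrightarrow> r \<le> s \<Longrightarrow> g s \<le> g r"
  using g_decreasing by (auto simp: monotone_on_def)

lemma G_antimono: "0 < r \<Longrightarrow> r \<le> s \<Longrightarrow> G s \<le> G r"
  using g_antimono[of r s] G_pos[of r] by (simp add: g_eq less_imp_le)

lemma g_dist_measurable [measurable]: "(\<lambda>u. g (norm (y - u))) \<in> borel_measurable (borel :: 'v measure)"
proof -
  have "(\<lambda>x::'v. g (norm x)) \<in> borel_measurable borel"
    using G0_excessive by (simp add: excessive_def)
  from measurable_compose[OF _ this, of "\<lambda>u. y - u" borel] show ?thesis by measurable
qed

definition ball_potential :: "'v \<Rightarrow> real \<Rightarrow> 'v \<Rightarrow> ennreal" where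
  "ball_potential z \<rho> y = (\<integral>\<^sup>+u\<in>ball z \<rho>. g (norm (y - u)) \<partial>lborel)"

text \<open>Condition (LD), read in polar coordinates.\<close>

lemma ball_potential_centre:
  assumes r: "R0 < r"
  shows "ball_potential y r y \<le> ennreal (C_LD * vol * r ^ DIM('v) * G r)"
proof -
  have r0: "0 < r" using r R0_nonneg by simp
  obtain b :: 'v where b: "norm b = 1" using vector_choose_size[of 1] by auto
  have "(\<lambda>s::real. g (norm (0 - s *\<^sub>R b))) \<in> borel_measurable borel"
    by (rule measurable_compose[OF _ g_dist_measurable[of 0]]) measurable
  then have meas: "(\<lambda>s::real. g \<bar>s\<bar>) \<in> borel_measurable borel" using b by simp
  have "ball_potential y r y = ennreal vol *
    (of_nat DIM('v) * (\<integral>\<^sup>+s\<in>{0<..<r}. ennreal (s ^ (DIM('v) - 1)) * g \<bar>s\<bar> \<partial>lborel))"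
    using nn_integral_ball_radial[OF meas r0, of y] by (simp add: ball_potential_def vol_def)
  also have "(\<integral>\<^sup>+s\<in>{0<..<r}. ennreal (s ^ (DIM('v) - 1)) * g \<bar>s\<bar> \<partial>lborel)
    = (\<integral>\<^sup>+s\<in>{0<..<r}. ennreal (s ^ (DIM('v) - 1)) * g s \<partial>lborel)"
    by (intro nn_integral_cong) (auto split: split_indicator)
  also have "ennreal vol * (of_nat DIM('v) * \<dots>) \<le> ennreal vol * (ennreal (C_LD * r ^ DIM('v)) * g r)"
    by (intro mult_left_mono C_LD(2) r) simp
  also have "\<dots> = ennreal (C_LD * vol * r ^ DIM('v) * G r)"
    using r0 C_LD(1) vol_pos G_pos[OF r0] by (simp add: g_eq ennreal_mult[symmetric] mult_ac)
  finally show ?thesis .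
qed

lemma ball_potential_mono: "ball z \<rho> \<subseteq> ball z' \<rho>' \<Longrightarrow> ball_potential z \<rho> y \<le> ball_potential z' \<rho>' y"
  unfolding ball_potential_def by (intro nn_integral_mono mult_left_mono) (auto split: split_indicator)

lemma nn_integral_const_ball:
  assumes "0 \<le> \<rho>" "0 \<le> c"
  shows "(\<integral>\<^sup>+u\<in>ball z \<rho>. ennreal c \<partial>(lborel::'v measure)) = ennreal (vol * \<rho> ^ DIM('v) * c)"
  using assms vol_pos
  by (simp add: nn_integral_cmult_indicator emeasure_ball vol_def[symmetric] ennreal_mult[symmetric] mult_ac)

lemma ball_potential_le_far:
  assumes "0 < \<rho>" "0 < a" and far: "\<And>u. u \<in> ball z \<rho> \<Longrightarrow> a \<le> norm (y - u)"
  shows "ball_potential z \<rho> y \<le> ennreal (vol * \<rho> ^ DIM('v) * G a)"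
proof -
  have "ball_potential z \<rho> y \<le> (\<integral>\<^sup>+u\<in>ball z \<rho>. ennreal (G a) \<partial>lborel)"
    unfolding ball_potential_def
  proof (intro nn_integral_mono)
    fix u
    show "g (norm (y - u)) * indicator (ball z \<rho>) u \<le> ennreal (G a) * indicator (ball z \<rho>) u"
      using far[of u] g_antimono[of a "norm (y - u)"] assms(2) by (auto simp: g_eq[symmetric] split: split_indicator)
  qed
  then show ?thesis using assms G_pos[of a] by (simp add: nn_integral_const_ball)
qed

lemma ball_potential_ge_near:
  assumes "0 \<le> \<rho>" "0 < b" and near: "\<And>u. u \<in> ball z \<rho> \<Longrightarrow> norm (y - u) \<le> b"
  shows "ennreal (vol * \<rho> ^ DIM('v) * G b) \<le> ball_potential z \<rho> y"
proof -
  have "(\<integral>\<^sup>+u\<in>ball z \<rho>. ennreal (G b) \<partial>lborel) \<le> ball_potential z \<rho> y"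
    unfolding ball_potential_def
  proof (intro nn_integral_mono)
    fix u
    show "ennreal (G b) * indicator (ball z \<rho>) u \<le> g (norm (y - u)) * indicator (ball z \<rho>) u"
      using near[of u] g_antimono[of "norm (y - u)" b] assms(2) by (auto simp: g_eq[symmetric] split: split_indicator)
  qed
  then show ?thesis using assms G_pos[of b] by (simp add: nn_integral_const_ball)
qed

text \<open>On \<open>B(0, r)\<close> the kernel is at least \<open>g r\<close>, whereas its integral over \<open>B(0, 2 * r)\<close> is controlled by
  \<open>g (2 * r)\<close>.\<close>

lemma G_doubling:
  assumes r: "0 < r" "R0 < 2 * r"
  shows "G r \<le> C_dbl * G (2 * r)"
proof -
  have "ennreal (vol * r ^ DIM('v) * G r) \<le> ball_potential 0 r 0"
    using r by (intro ball_potential_ge_near) auto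
  also have "\<dots> \<le> ball_potential 0 (2 * r) 0"
    using r by (intro ball_potential_mono) (auto simp: dist_norm)
  also have "\<dots> \<le> ennreal (C_LD * vol * (2 * r) ^ DIM('v) * G (2 * r))"
    using r by (intro ball_potential_centre)
  finally have "vol * r ^ DIM('v) * G r \<le> C_LD * vol * (2 * r) ^ DIM('v) * G (2 * r)"
    using r C_LD(1) vol_pos G_pos[of "2 * r"] by (subst (asm) ennreal_le_iff) auto
  also have "\<dots> = vol * r ^ DIM('v) * (C_dbl * G (2 * r))"
    by (simp add: C_dbl_def power_mult_distrib)
  finally show ?thesis using r vol_pos by simp
qed

text \<open>Points close to the ball see it inside a ball of comparable radius centred at themselves; for points
  far away the kernel is at most \<open>g \<rho>\<close> on the ball.\<close>

lemma ball_potential_le_uniform: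
  assumes \<rho>: "R0 < \<rho>"
  shows "ball_potential z \<rho> y \<le> ennreal (3 ^ DIM('v) * C_LD * (vol * \<rho> ^ DIM('v) * G \<rho>))"
proof -
  have \<rho>0: "0 < \<rho>" using \<rho> R0_nonneg by simp
  have base: "0 \<le> vol * \<rho> ^ DIM('v) * G \<rho>" using \<rho>0 vol_pos G_pos[of \<rho>] by simp
  show ?thesis
  proof (cases "norm (y - z) < 2 * \<rho>")
    case True
    have "ball_potential z \<rho> y \<le> ball_potential y (3 * \<rho>) y"
    proof (intro ball_potential_mono subsetI)
      fix u assume "u \<in> ball z \<rho>"
      then show "u \<in> ball y (3 * \<rho>)"
        using True dist_triangle[of y u z] by (simp add: dist_norm norm_minus_commute)
    qed
    also have "\<dots> \<le> ennreal (C_LD * vol * (3 * \<rho>) ^ DIM('v) * G (3 * \<rho>))"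
      using \<rho> \<rho>0 by (intro ball_potential_centre) simp
    also have "C_LD * vol * (3 * \<rho>) ^ DIM('v) * G (3 * \<rho>) \<le> C_LD * vol * (3 * \<rho>) ^ DIM('v) * G \<rho>"
      using \<rho>0 C_LD(1) vol_pos by (intro mult_left_mono G_antimono) auto
    also have "\<dots> = 3 ^ DIM('v) * C_LD * (vol * \<rho> ^ DIM('v) * G \<rho>)"
      by (simp add: power_mult_distrib)
    finally show ?thesis by (simp add: ennreal_leI)
  next
    case False
    have "ball_potential z \<rho> y \<le> ennreal (vol * \<rho> ^ DIM('v) * G \<rho>)"
    proof (intro ball_potential_le_far \<rho>0)
      fix u assume "u \<in> ball z \<rho>"
      then show "\<rho> \<le> norm (y - u)"
        using False dist_triangle[of y z u] by (simp add: dist_norm norm_minus_commute)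
    qed
    also have "vol * \<rho> ^ DIM('v) * G \<rho> \<le> 3 ^ DIM('v) * C_LD * (vol * \<rho> ^ DIM('v) * G \<rho>)"
      using base C_LD(1) mult_mono[of 1 "3 ^ DIM('v)" 1 C_LD] mult_right_mono[of 1 "3 ^ DIM('v) * C_LD"] by simp
    finally show ?thesis by (simp add: ennreal_leI)
  qed
qed

text \<open>Far away from \<open>z\<close> this is doubling; for \<open>norm (y - z) < 2 * \<rho>\<close> the uniform bound suffices, since
  \<open>g \<rho>\<close> is then at most a multiple of \<open>g (norm (y - z))\<close>.\<close>

lemma ball_potential_le_point:
  assumes \<rho>: "R0 < \<rho>" and y: "y \<noteq> z"
  shows "ball_potential z \<rho> y \<le> ennreal (3 ^ DIM('v) * C_LD * C_dbl * (vol * \<rho> ^ DIM('v) * G (norm (y - z))))"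
proof -
  have \<rho>0: "0 < \<rho>" using \<rho> R0_nonneg by simp
  have pos: "0 < norm (y - z)" using y by simp
  have C3: "1 \<le> 3 ^ DIM('v) * C_LD"
    using C_LD(1) mult_mono[of 1 "3 ^ DIM('v)" 1 C_LD] by simp
  show ?thesis
  proof (cases "norm (y - z) < 2 * \<rho>")
    case True
    have "G \<rho> \<le> C_dbl * G (2 * \<rho>)" using \<rho> \<rho>0 by (intro G_doubling) auto
    also have "\<dots> \<le> C_dbl * G (norm (y - z))"
      using True pos C_dbl_ge_1 by (intro mult_left_mono G_antimono) auto
    finally have "3 ^ DIM('v) * C_LD * (vol * \<rho> ^ DIM('v) * G \<rho>) \<le> 3 ^ DIM('v) * C_LD * (vol * \<rho> ^ DIM('v) * (C_dbl * G (norm (y - z))))"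
      using C_LD(1) vol_pos \<rho>0 by (intro mult_left_mono) auto
    then show ?thesis
      using ball_potential_le_uniform[OF \<rho>, of z y] by (auto elim!: order_trans intro!: ennreal_leI simp: mult_ac)
  next
    case False
    have "ball_potential z \<rho> y \<le> ennreal (vol * \<rho> ^ DIM('v) * G (norm (y - z) / 2))"
    proof (intro ball_potential_le_far \<rho>0)
      fix u assume "u \<in> ball z \<rho>"
      then show "norm (y - z) / 2 \<le> norm (y - u)"
        using False dist_triangle[of y z u] by (simp add: dist_norm norm_minus_commute)
    qed (use pos in simp)
    also have "vol * \<rho> ^ DIM('v) * G (norm (y - z) / 2) \<le> vol * \<rho> ^ DIM('v) * (C_dbl * G (norm (y - z)))"
      using G_doubling[of "norm (y - z) / 2"] False pos \<rho> \<rho>0 vol_pos by (intro mult_left_mono) auto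
    also have "\<dots> \<le> 3 ^ DIM('v) * C_LD * (vol * \<rho> ^ DIM('v) * (C_dbl * G (norm (y - z))))"
      using C3 vol_pos \<rho>0 C_dbl_ge_1 G_pos[OF pos] mult_right_mono[of 1 "3 ^ DIM('v) * C_LD" "vol * \<rho> ^ DIM('v) * (C_dbl * G (norm (y - z)))"]
      by simp
    finally show ?thesis by (simp add: ennreal_leI mult_ac)
  qed
qed

text \<open>The ball is contained in \<open>B(x, 4 * norm z)\<close>, and two doublings compare \<open>g (4 * norm z)\<close> with
  \<open>g (norm z)\<close>.\<close>

lemma ball_potential_ge_point:
  assumes "0 < \<rho>" "\<rho> \<le> norm z" "R0 < norm z" "norm x \<le> norm z"
  shows "ennreal (vol * \<rho> ^ DIM('v) * G (norm z) / C_dbl\<^sup>2) \<le> ball_potential z \<rho> x"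
proof -
  have z: "0 < norm z" using assms by linarith
  have "G (norm z) \<le> C_dbl * G (2 * norm z)" using assms z by (intro G_doubling) auto
  also have "\<dots> \<le> C_dbl * (C_dbl * G (2 * (2 * norm z)))"
    using assms z C_dbl_ge_1 by (intro mult_left_mono G_doubling) auto
  finally have "G (norm z) / C_dbl\<^sup>2 \<le> G (4 * norm z)"
    using C_dbl_ge_1 by (simp add: field_simps power2_eq_square)
  then have "vol * \<rho> ^ DIM('v) * (G (norm z) / C_dbl\<^sup>2) \<le> vol * \<rho> ^ DIM('v) * G (4 * norm z)"
    using assms vol_pos by (intro mult_left_mono) auto
  then have "ennreal (vol * \<rho> ^ DIM('v) * G (norm z) / C_dbl\<^sup>2) \<le> ennreal (vol * \<rho> ^ DIM('v) * G (4 * norm z))"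
    by (intro ennreal_leI) simp
  also have "\<dots> \<le> ball_potential z \<rho> x"
  proof (intro ball_potential_ge_near)
    fix u assume "u \<in> ball z \<rho>"
    then have "dist z u < \<rho>" by simp
    then show "norm (x - u) \<le> 4 * norm z"
      using assms norm_triangle_ineq4[of x u] norm_triangle_ineq4[of z "z - u"] by (simp add: dist_norm)
  qed (use assms z in auto)
  finally show ?thesis .
qed

definition weight :: "('v \<Rightarrow> real) \<Rightarrow> 'v \<Rightarrow> real" where
  "weight r z = G (norm z) / G (r z)"

text \<open>The packing argument. The assumptions \<open>sep\<close> make the balls \<open>B(z, \<rho> z)\<close> disjoint, where
  \<open>(2 * \<rho> z) ^ d = e * norm z ^ d * weight r z\<close>. A centre \<open>z\<close> other than the nearest one satisfies
  \<open>norm (z - z1) \<le> 2 * norm (y - z)\<close>, hence \<open>\<rho> z \<le> norm (y - z)\<close>: the point \<open>y\<close> sees all points of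
  \<open>B(z, \<rho> z)\<close> at distance at most \<open>2 * norm (y - z)\<close>, and the sum becomes an integral of the kernel. The
  assumptions \<open>rsep\<close> keep these distances in the range where doubling is available.\<close>

lemma near_sum_le:
  assumes fin: "finite F" and e: "0 < e"
    and r: "\<And>z. z \<in> F \<Longrightarrow> R0 < r z" and z: "\<And>z. z \<in> F \<Longrightarrow> R0 < norm z"
    and sep: "\<And>z z'. z \<in> F \<Longrightarrow> z' \<in> F \<Longrightarrow> z \<noteq> z' \<Longrightarrow> e * norm z ^ DIM('v) * weight r z \<le> norm (z - z') ^ DIM('v)"
    and rsep: "\<And>z z'. z \<in> F \<Longrightarrow> z' \<in> F \<Longrightarrow> z \<noteq> z' \<Longrightarrow> r z \<le> norm (z - z')"
    and z1: "z1 \<in> F" "\<And>z. z \<in> F \<Longrightarrow> norm (y - z1) \<le> norm (y - z)"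
  shows "(\<Sum>z\<in>{z\<in>F - {z1}. norm (y - z) < norm z / 2}. G (norm (y - z)) / G (r z)) \<le> 6 ^ DIM('v) * C_LD * C_dbl / e"
    (is "(\<Sum>z\<in>?B. _) \<le> _")
proof (cases "?B = {}")
  case True
  have "0 \<le> 6 ^ DIM('v) * C_LD * C_dbl / e" using e C_LD(1) C_dbl_ge_1 by simp
  then show ?thesis using True by (simp only: sum.empty)
next
  case False
  let ?d = "DIM('v)"
  define \<rho> where "\<rho> z = root ?d (e * weight r z) * norm z / 2" for z
  have rpos: "0 < r z" "0 < norm z" "0 < weight r z" if "z \<in> F" for z
  proof -
    show "0 < r z" "0 < norm z" using r[OF that] z[OF that] R0_nonneg by linarith+
    then show "0 < weight r z" unfolding weight_def by (intro divide_pos_pos G_pos)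
  qed
  have \<rho>0: "0 < \<rho> z" if "z \<in> F" for z
    using rpos[OF that] e by (simp add: \<rho>_def)
  have \<rho>d: "(2 * \<rho> z) ^ ?d = e * norm z ^ ?d * weight r z" if "z \<in> F" for z
    using rpos[OF that] e by (simp add: \<rho>_def power_mult_distrib real_root_pow_pos2)
  have \<rho>sep: "2 * \<rho> z \<le> norm (z - z')" if "z \<in> F" "z' \<in> F" "z \<noteq> z'" for z z'
  proof (rule power_le_imp_le_base)
    show "(2 * \<rho> z) ^ Suc (?d - 1) \<le> norm (z - z') ^ Suc (?d - 1)"
      using sep[OF that] \<rho>d[OF that(1)] by simp
  qed simp
  have B: "z \<in> F" "\<rho> z \<le> norm (y - z)" "r z \<le> 2 * norm (y - z)" "norm (y - z) < norm z / 2" "norm z < 2 * norm y"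
    "norm y < 3 / 2 * norm z" if "z \<in> ?B" for z
  proof -
    show zF: "z \<in> F" and near: "norm (y - z) < norm z / 2" using that by auto
    have "norm (z - z1) \<le> 2 * norm (y - z)"
      using z1(2)[OF zF] norm_triangle_ineq4[of "y - z1" "y - z"] by simp
    then show "\<rho> z \<le> norm (y - z)" "r z \<le> 2 * norm (y - z)"
      using \<rho>sep[OF zF z1(1)] rsep[OF zF z1(1)] that by auto
    show "norm z < 2 * norm y" "norm y < 3 / 2 * norm z"
      using near norm_triangle_ineq2[of z y] norm_triangle_ineq2[of y z] by (auto simp: norm_minus_commute)
  qed
  obtain z0 where z0: "z0 \<in> ?B" using False by blast
  have y0: "R0 < 2 * norm y" "0 < norm y" using B[OF z0] z[of z0] rpos[of z0] by auto
  have disj: "disjoint_family_on (\<lambda>z. ball z (\<rho> z)) ?B"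
    unfolding disjoint_family_on_def
  proof (intro ballI impI)
    fix z z' assume zz': "z \<in> ?B" "z' \<in> ?B" "z \<noteq> z'"
    have "\<rho> z + \<rho> z' \<le> dist z z'"
      using \<rho>sep[of z z'] \<rho>sep[of z' z] zz' by (simp add: dist_norm norm_minus_commute)
    then show "ball z (\<rho> z) \<inter> ball z' (\<rho> z') = {}" by (rule disjoint_ballI)
  qed
  have "ennreal (\<Sum>z\<in>?B. vol * \<rho> z ^ ?d * G (2 * norm (y - z))) = (\<Sum>z\<in>?B. ennreal (vol * \<rho> z ^ ?d * G (2 * norm (y - z))))"
  proof (rule sum_ennreal[symmetric])
    fix z assume "z \<in> ?B"
    from B[OF this] \<rho>0[of z] have "0 < \<rho> z" "0 < 2 * norm (y - z)" by linarith+
    then show "0 \<le> vol * \<rho> z ^ ?d * G (2 * norm (y - z))"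
      using vol_pos G_pos[of "2 * norm (y - z)"] by (intro mult_nonneg_nonneg) auto
  qed
  also have "\<dots> \<le> (\<Sum>z\<in>?B. ball_potential z (\<rho> z) y)"
  proof (intro sum_mono ball_potential_ge_near)
    fix z assume zB: "z \<in> ?B"
    show "0 \<le> \<rho> z" "0 < 2 * norm (y - z)" using B[OF zB] \<rho>0[of z] by auto
    fix u assume "u \<in> ball z (\<rho> z)"
    then show "norm (y - u) \<le> 2 * norm (y - z)"
      using B[OF zB] dist_triangle[of y u z] by (simp add: dist_norm norm_minus_commute)
  qed
  also have "\<dots> = (\<integral>\<^sup>+u. (\<Sum>z\<in>?B. g (norm (y - u)) * indicator (ball z (\<rho> z)) u) \<partial>lborel)"
    unfolding ball_potential_def by (subst nn_integral_sum) auto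
  also have "\<dots> \<le> ball_potential y (2 * norm y) y"
    unfolding ball_potential_def
  proof (rule nn_integral_mono)
    fix u
    have "(\<Sum>z\<in>?B. g (norm (y - u)) * indicator (ball z (\<rho> z)) u) = g (norm (y - u)) * (\<Sum>z\<in>?B. indicator (ball z (\<rho> z)) u)"
      by (simp add: sum_distrib_left)
    also have "(\<Sum>z\<in>?B. indicator (ball z (\<rho> z)) u :: ennreal) = indicator (\<Union>z\<in>?B. ball z (\<rho> z)) u"
      using fin disj by (intro indicator_UN_disjoint[symmetric]) auto
    also have "\<dots> \<le> indicator (ball y (2 * norm y)) u"
    proof -
      have "u \<in> ball y (2 * norm y)" if "z \<in> ?B" "u \<in> ball z (\<rho> z)" for z
        using B[OF that(1)] that(2) dist_triangle[of y u z] by (simp add: dist_norm norm_minus_commute)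
      then show ?thesis by (auto split: split_indicator)
    qed
    finally show "(\<Sum>z\<in>?B. g (norm (y - u)) * indicator (ball z (\<rho> z)) u) \<le> g (norm (y - u)) * indicator (ball y (2 * norm y)) u"
      by (simp add: mult_left_mono)
  qed
  also have "\<dots> \<le> ennreal (C_LD * vol * (2 * norm y) ^ ?d * G (2 * norm y))"
    by (rule ball_potential_centre[OF y0(1)])
  finally have packing: "(\<Sum>z\<in>?B. vol * \<rho> z ^ ?d * G (2 * norm (y - z))) \<le> C_LD * vol * (2 * norm y) ^ ?d * G (2 * norm y)"
    using y0 C_LD(1) vol_pos G_pos[of "2 * norm y"] by (subst (asm) ennreal_le_iff) auto
  \<comment> \<open>Since \<open>norm z\<close> and \<open>norm y\<close> are comparable, each term is at most \<open>c\<close> times its share of the packing sum.\<close>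
  define c where "c = C_dbl * 3 ^ ?d / (e * vol * norm y ^ ?d * G (2 * norm y))"
  have c: "0 \<le> c" using y0 e C_dbl_ge_1 vol_pos G_pos[of "2 * norm y"] by (auto simp: c_def intro!: divide_nonneg_nonneg mult_nonneg_nonneg)
  have "(\<Sum>z\<in>?B. G (norm (y - z)) / G (r z)) \<le> (\<Sum>z\<in>?B. c * (vol * \<rho> z ^ ?d * G (2 * norm (y - z))))"
  proof (rule sum_mono)
    fix z assume zB: "z \<in> ?B"
    note b = B[OF zB]
    have pos: "0 < norm (y - z)" using b(2) \<rho>0[OF b(1)] by linarith
    have P1: "G (norm (y - z)) \<le> C_dbl * G (2 * norm (y - z))"
      using pos b(3) r[OF b(1)] by (intro G_doubling) auto
    have P2: "G (2 * norm y) \<le> G (norm z)"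
      using b(5) rpos[OF b(1)] by (intro G_antimono) auto
    have "norm y ^ ?d \<le> (3 / 2 * norm z) ^ ?d"
      using b(6) by (intro power_mono) auto
    then have P3: "norm y ^ ?d * 2 ^ ?d \<le> 3 ^ ?d * norm z ^ ?d"
      by (simp add: power_mult_distrib power_divide field_simps)
    have Gs: "0 < G (2 * norm y)" "0 < G (norm z)" "0 < G (r z)" "0 < G (2 * norm (y - z))"
      using y0 rpos[OF b(1)] pos by (auto intro!: G_pos)
    have "norm y ^ ?d * 2 ^ ?d * G (2 * norm y) \<le> 3 ^ ?d * norm z ^ ?d * G (norm z)"
      using P3 P2 by (rule mult_mono) (use Gs in auto)
    then have "norm y ^ ?d * 2 ^ ?d * G (2 * norm y) * e / G (r z) \<le> 3 ^ ?d * norm z ^ ?d * G (norm z) * e / G (r z)"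
      using Gs e by (intro divide_right_mono mult_right_mono) auto
    also have "\<dots> = 3 ^ ?d * (2 * \<rho> z) ^ ?d"
      unfolding \<rho>d[OF b(1)] by (simp add: weight_def)
    finally have "2 ^ ?d * (norm y ^ ?d * G (2 * norm y) * e / G (r z)) \<le> 2 ^ ?d * (3 ^ ?d * \<rho> z ^ ?d)"
      by (simp add: power_mult_distrib mult_ac)
    then have "norm y ^ ?d * G (2 * norm y) * e / G (r z) \<le> 3 ^ ?d * \<rho> z ^ ?d"
      by (rule mult_left_le_imp_le) simp
    then have "1 / G (r z) \<le> 3 ^ ?d * \<rho> z ^ ?d / (norm y ^ ?d * G (2 * norm y) * e)"
      using Gs e y0 by (simp add: field_simps)
    then have "G (norm (y - z)) * (1 / G (r z)) \<le> C_dbl * G (2 * norm (y - z)) * (3 ^ ?d * \<rho> z ^ ?d / (norm y ^ ?d * G (2 * norm y) * e))"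
      using P1 Gs C_dbl_ge_1 by (intro mult_mono) auto
    also have "\<dots> = c * (vol * \<rho> z ^ ?d * G (2 * norm (y - z)))"
      using vol_pos by (simp add: c_def mult_ac)
    finally show "G (norm (y - z)) / G (r z) \<le> c * (vol * \<rho> z ^ ?d * G (2 * norm (y - z)))" by simp
  qed
  also have "\<dots> \<le> c * (C_LD * vol * (2 * norm y) ^ ?d * G (2 * norm y))"
    unfolding sum_distrib_left[symmetric] using packing c by (rule mult_left_mono)
  also have "\<dots> = (3 ^ ?d * 2 ^ ?d) * C_LD * C_dbl / e"
    using vol_pos y0 G_pos[of "2 * norm y"] by (simp add: c_def power_mult_distrib)
  also have "(3 ^ ?d * 2 ^ ?d :: real) = 6 ^ ?d"
    by (simp add: power_mult_distrib[symmetric])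
  finally show ?thesis .
qed

text \<open>The factors make the potential of each summand on its own ball at most a constant,
  uniformly in the radius.\<close>

definition normalized_balls :: "'v set \<Rightarrow> ('v \<Rightarrow> real) \<Rightarrow> 'v \<Rightarrow> ennreal" where
  "normalized_balls F r y = (\<Sum>z\<in>F. ennreal (1 / (vol * r z ^ DIM('v) * G (r z))) * indicator (ball z (r z)) y)"

lemma normalized_balls_measurable [measurable]: "normalized_balls F r \<in> borel_measurable borel"
  unfolding normalized_balls_def[abs_def] by measurable

lemma potential_normalized_balls:
  "potential_kernel Q (normalized_balls F r) y =
    (\<Sum>z\<in>F. ennreal (1 / (vol * r z ^ DIM('v) * G (r z))) * ball_potential z (r z) y)"
proof -
  have "potential_kernel Q (normalized_balls F r) y = (\<integral>\<^sup>+u. g (norm (y - u)) * normalized_balls F r u \<partial>lborel)"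
    by (rule potential_kernel_eq) simp
  also have "\<dots> = (\<integral>\<^sup>+u. (\<Sum>z\<in>F. ennreal (1 / (vol * r z ^ DIM('v) * G (r z))) * (g (norm (y - u)) * indicator (ball z (r z)) u)) \<partial>lborel)"
    unfolding normalized_balls_def by (simp add: sum_distrib_left mult_ac)
  also have "\<dots> = (\<Sum>z\<in>F. ennreal (1 / (vol * r z ^ DIM('v) * G (r z))) * ball_potential z (r z) y)"
    unfolding ball_potential_def by (subst nn_integral_sum; simp add: nn_integral_cmult)
  finally show ?thesis .
qed

lemma mult_normalizer_le:
  assumes "0 < r" "0 < G r" "p \<le> ennreal (K * (vol * r ^ DIM('v) * a))"
  shows "ennreal (1 / (vol * r ^ DIM('v) * G r)) * p \<le> ennreal (K * (a / G r))"
proof -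
  have "ennreal (1 / (vol * r ^ DIM('v) * G r)) * p
    \<le> ennreal (1 / (vol * r ^ DIM('v) * G r)) * ennreal (K * (vol * r ^ DIM('v) * a))"
    using assms(3) by (rule mult_left_mono) simp
  also have "\<dots> = ennreal (K * (a / G r))"
    using assms vol_pos by (subst ennreal_mult'[symmetric]) auto
  finally show ?thesis .
qed

text \<open>The centre \<open>z1\<close> nearest to \<open>y\<close> is treated by the uniform bound, the centres at distance at least
  \<open>norm z / 2\<close> by doubling, and the remaining ones by packing.\<close>

lemma potential_normalized_balls_le:
  assumes fin: "finite F" and e: "0 < e"
    and r: "\<And>z. z \<in> F \<Longrightarrow> R0 < r z" and z: "\<And>z. z \<in> F \<Longrightarrow> R0 < norm z"
    and sep: "\<And>z z'. z \<in> F \<Longrightarrow> z' \<in> F \<Longrightarrow> z \<noteq> z' \<Longrightarrow> e * norm z ^ DIM('v) * weight r z \<le> norm (z - z') ^ DIM('v)"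
    and rsep: "\<And>z z'. z \<in> F \<Longrightarrow> z' \<in> F \<Longrightarrow> z \<noteq> z' \<Longrightarrow> r z \<le> norm (z - z')"
  shows "potential_kernel Q (normalized_balls F r) y
    \<le> ennreal (3 ^ DIM('v) * C_LD * (1 + C_dbl * (C_dbl * sum (weight r) F + 6 ^ DIM('v) * C_LD * C_dbl / e)))"
proof (cases "F = {}")
  case True
  then show ?thesis by (simp add: potential_normalized_balls)
next
  case False
  let ?d = "DIM('v)" and ?p = "\<lambda>z. ennreal (1 / (vol * r z ^ DIM('v) * G (r z))) * ball_potential z (r z) y"
  define K where "K = 3 ^ ?d * C_LD"
  have K: "0 \<le> K" using C_LD(1) by (simp add: K_def)
  have pos: "0 < r z" "0 < G (r z)" "0 < norm z" "0 < G (norm z)" "0 < weight r z" if "z \<in> F" for z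
  proof -
    show "0 < r z" "0 < norm z" using r[OF that] z[OF that] R0_nonneg by linarith+
    then show "0 < G (r z)" "0 < G (norm z)" by (simp_all only: G_pos)
    then show "0 < weight r z" by (simp add: weight_def)
  qed
  obtain z1 where z1: "z1 \<in> F" "\<And>z. z \<in> F \<Longrightarrow> norm (y - z1) \<le> norm (y - z)"
    using arg_min_if_finite[OF fin False, of "\<lambda>z. norm (y - z)"] by (metis not_le)
  have other: "z \<noteq> y" if "z \<in> F - {z1}" for z
  proof
    assume "z = y"
    then have "norm (y - z1) \<le> 0" using z1(2)[of z] that by simp
    then show False using \<open>z = y\<close> that by simp
  qed
  have p1: "?p z1 \<le> ennreal K"
    using mult_normalizer_le[OF pos(1,2)[OF z1(1)], of "ball_potential z1 (r z1) y" K "G (r z1)"]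
      ball_potential_le_uniform[OF r[OF z1(1)], of z1 y] pos(2)[OF z1(1)] by (simp add: K_def)
  have p2: "?p z \<le> ennreal (K * C_dbl * (G (norm (y - z)) / G (r z)))" if "z \<in> F - {z1}" for z
    using that other[OF that] pos[of z] r[of z] unfolding K_def
    by (intro mult_normalizer_le ball_potential_le_point) auto
  have Gdist: "0 \<le> G (norm (y - z)) / G (r z)" if "z \<in> F - {z1}" for z
    using that other[OF that] pos[of z] G_pos[of "norm (y - z)"] by auto
  have "(\<Sum>z\<in>F - {z1}. G (norm (y - z)) / G (r z))
    \<le> (\<Sum>z\<in>F - {z1}. C_dbl * weight r z + (if norm (y - z) < norm z / 2 then G (norm (y - z)) / G (r z) else 0))"
  proof (rule sum_mono)
    fix z assume zF: "z \<in> F - {z1}"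
    then have zF': "z \<in> F" by simp
    show "G (norm (y - z)) / G (r z) \<le> C_dbl * weight r z + (if norm (y - z) < norm z / 2 then G (norm (y - z)) / G (r z) else 0)"
    proof (cases "norm (y - z) < norm z / 2")
      case True
      then show ?thesis using pos(5)[OF zF'] C_dbl_ge_1 by simp
    next
      case False
      have "G (norm (y - z)) \<le> G (norm z / 2)"
        using False pos[OF zF'] by (intro G_antimono) auto
      also have "\<dots> \<le> C_dbl * G (2 * (norm z / 2))"
        using pos[OF zF'] z[OF zF'] by (intro G_doubling) auto
      finally have "G (norm (y - z)) / G (r z) \<le> C_dbl * G (norm z) / G (r z)"
        using pos[OF zF'] by (intro divide_right_mono) auto
      then show ?thesis using False by (simp add: weight_def)
    qed
  qed
  also have "\<dots> = (\<Sum>z\<in>F - {z1}. C_dbl * weight r z) + (\<Sum>z\<in>{z\<in>F - {z1}. norm (y - z) < norm z / 2}. G (norm (y - z)) / G (r z))"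
    using fin by (simp only: sum.distrib sum.inter_filter[symmetric] finite_Diff)
  also have "\<dots> \<le> C_dbl * sum (weight r) F + 6 ^ ?d * C_LD * C_dbl / e"
  proof (rule add_mono)
    show "(\<Sum>z\<in>F - {z1}. C_dbl * weight r z) \<le> C_dbl * sum (weight r) F"
      unfolding sum_distrib_left using fin pos(5) C_dbl_ge_1 by (intro sum_mono2) (auto simp: less_imp_le)
    show "(\<Sum>z\<in>{z\<in>F - {z1}. norm (y - z) < norm z / 2}. G (norm (y - z)) / G (r z)) \<le> 6 ^ ?d * C_LD * C_dbl / e"
      using fin e r z sep rsep z1 by (rule near_sum_le)
  qed
  finally have sum: "(\<Sum>z\<in>F - {z1}. G (norm (y - z)) / G (r z)) \<le> C_dbl * sum (weight r) F + 6 ^ ?d * C_LD * C_dbl / e" .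
  have "potential_kernel Q (normalized_balls F r) y = ?p z1 + sum ?p (F - {z1})"
    unfolding potential_normalized_balls using fin z1(1) by (rule sum.remove)
  also have "\<dots> \<le> ennreal K + (\<Sum>z\<in>F - {z1}. ennreal (K * C_dbl * (G (norm (y - z)) / G (r z))))"
    by (intro add_mono p1 sum_mono p2)
  also have "\<dots> = ennreal K + ennreal (\<Sum>z\<in>F - {z1}. K * C_dbl * (G (norm (y - z)) / G (r z)))"
    using K C_dbl_ge_1 by (subst sum_ennreal) (auto simp del: times_divide_eq_right intro!: mult_nonneg_nonneg Gdist)
  also have "\<dots> = ennreal (K + K * C_dbl * (\<Sum>z\<in>F - {z1}. G (norm (y - z)) / G (r z)))"
    unfolding sum_distrib_left[symmetric]
    using K C_dbl_ge_1 Gdist by (intro ennreal_plus[symmetric] mult_nonneg_nonneg sum_nonneg) auto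
  also have "\<dots> \<le> ennreal (K + K * C_dbl * (C_dbl * sum (weight r) F + 6 ^ ?d * C_LD * C_dbl / e))"
    using K C_dbl_ge_1 sum by (intro ennreal_leI add_left_mono mult_left_mono) auto
  also have "K + K * C_dbl * (C_dbl * sum (weight r) F + 6 ^ ?d * C_LD * C_dbl / e)
    = K * (1 + C_dbl * (C_dbl * sum (weight r) F + 6 ^ ?d * C_LD * C_dbl / e))"
    by (simp add: distrib_left)
  finally show ?thesis by (simp only: K_def)
qed

lemma potential_normalized_balls_ge:
  assumes fin: "finite F"
    and r: "\<And>z. z \<in> F \<Longrightarrow> R0 < r z \<and> r z \<le> norm z" and x: "\<And>z. z \<in> F \<Longrightarrow> norm x \<le> norm z"
  shows "ennreal (sum (weight r) F / C_dbl\<^sup>2) \<le> potential_kernel Q (normalized_balls F r) x"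
proof -
  have pos: "0 < r z" "0 < G (r z)" "0 < G (norm z)" if "z \<in> F" for z
    using r[OF that] R0_nonneg by (auto intro!: G_pos)
  have "ennreal (sum (weight r) F / C_dbl\<^sup>2) = (\<Sum>z\<in>F. ennreal (weight r z / C_dbl\<^sup>2))"
    unfolding sum_divide_distrib using pos by (intro sum_ennreal[symmetric]) (auto simp: weight_def less_imp_le)
  also have "\<dots> \<le> (\<Sum>z\<in>F. ennreal (1 / (vol * r z ^ DIM('v) * G (r z))) * ball_potential z (r z) x)"
  proof (rule sum_mono)
    fix z assume zF: "z \<in> F"
    have "ennreal (weight r z / C_dbl\<^sup>2) = ennreal (1 / (vol * r z ^ DIM('v) * G (r z))) * ennreal (vol * r z ^ DIM('v) * G (norm z) / C_dbl\<^sup>2)"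
      using pos[OF zF] vol_pos by (subst ennreal_mult'[symmetric]) (auto simp: weight_def)
    also have "\<dots> \<le> ennreal (1 / (vol * r z ^ DIM('v) * G (r z))) * ball_potential z (r z) x"
      using pos[OF zF] r[OF zF] x[OF zF] by (intro mult_left_mono ball_potential_ge_point) auto
    finally show "ennreal (weight r z / C_dbl\<^sup>2) \<le> ennreal (1 / (vol * r z ^ DIM('v) * G (r z))) * ball_potential z (r z) x" .
  qed
  finally show ?thesis by (simp add: potential_normalized_balls)
qed

end

section \<open>Separated balls with divergent weights\<close>

lemma finite_subset_sum_ge_1:
  fixes f :: "'a \<Rightarrow> ennreal"
  assumes inf: "(\<Sum>\<^sub>\<infinity>z\<in>Z. f z) = \<infinity>" and E: "finite E" "\<And>z. z \<in> E \<Longrightarrow> f z < \<infinity>"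
  obtains F where "finite F" "F \<subseteq> Z - E" "1 \<le> sum f F"
proof (rule ccontr)
  assume contr: "\<not> thesis"
  have "(\<Sum>\<^sub>\<infinity>z\<in>Z. f z) \<le> 1 + sum f E"
  proof (rule infsum_le_finite_sums)
    fix F assume F: "finite F" "F \<subseteq> Z"
    have "sum f (F - E) \<le> 1"
      using that[of "F - E"] contr F by (meson Diff_mono finite_Diff nle_le order_refl)
    moreover have "sum f (F \<inter> E) \<le> sum f E" using E(1) by (intro sum_mono2) auto
    moreover have "sum f F = sum f (F - E) + sum f (F \<inter> E)"
      using F(1) by (metis add.commute sum.Int_Diff)
    ultimately show "sum f F \<le> 1 + sum f E" by (simp add: add_mono)
  qed (rule nonneg_summable_on_complete, simp)
  moreover have "sum f E < \<infinity>" using E by (simp add: less_top)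
  ultimately show False using inf by (simp add: top_unique)
qed

context isotropic_potential
begin

text \<open>The infimum may be \<open>\<infinity>\<close>, so the constant is the minimum of the infimum and 1.\<close>

lemma separation_condition_real:
  assumes sep: "separation_condition g Z r" and Z0: "0 \<notin> Z" and r: "\<And>z. z \<in> Z \<Longrightarrow> 0 < r z"
  obtains e where "0 < e"
    "\<And>z z'. z \<in> Z \<Longrightarrow> z' \<in> Z \<Longrightarrow> z \<noteq> z' \<Longrightarrow> e * norm z ^ DIM('v) * weight r z \<le> norm (z - z') ^ DIM('v)"
proof -
  define i where "i = (INF (z, z')\<in>{(z, z'). z \<in> Z \<and> z' \<in> Z \<and> z \<noteq> z'}.
      ennreal (norm (z - z') ^ DIM('v) / norm z ^ DIM('v)) * (g (r z) / g (norm z)))"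
  have "0 < i" using sep by (simp add: separation_condition_def i_def)
  then have "0 < min i 1" by simp
  then obtain e where e: "min i 1 = ennreal e" "0 < e"
    by (metis ennreal_cases ennreal_eq_0_iff ennreal_one_neq_top linorder_not_less min.cobounded2 neq_top_trans order_less_irrefl)
  have "e * norm z ^ DIM('v) * weight r z \<le> norm (z - z') ^ DIM('v)" if zz': "z \<in> Z" "z' \<in> Z" "z \<noteq> z'" for z z'
  proof -
    have pos: "0 < norm z" "0 < r z" using zz' Z0 r by auto
    note Gpos = pos[THEN G_pos]
    have "ennreal e \<le> i" using e(1) by (metis min.cobounded1)
    also have "i \<le> ennreal (norm (z - z') ^ DIM('v) / norm z ^ DIM('v)) * (g (r z) / g (norm z))"
      unfolding i_def using zz' by (intro INF_lower2[of "(z, z')"]) auto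
    also have "\<dots> = ennreal (norm (z - z') ^ DIM('v) / norm z ^ DIM('v) * (G (r z) / G (norm z)))"
      using Gpos pos by (simp add: g_eq divide_ennreal ennreal_mult[symmetric])
    finally have "e \<le> norm (z - z') ^ DIM('v) / norm z ^ DIM('v) * (G (r z) / G (norm z))"
      using Gpos by (subst (asm) ennreal_le_iff) auto
    then show ?thesis using Gpos pos by (simp add: weight_def field_simps)
  qed
  then show ?thesis using e(2) that by blast
qed

lemma normalized_balls_zero_outside:
  "y \<notin> (\<Union>z\<in>F. ball z (r z)) \<Longrightarrow> normalized_balls F r y = 0"
  by (simp add: normalized_balls_def)

end

theorem theorem1p2:
  fixes Q :: "real \<Rightarrow> 'v::euclidean_space \<Rightarrow> 'v measure"
    and g :: "real \<Rightarrow> ennreal" and R0 :: real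
    and M :: "'w measure" and F :: "ennreal \<Rightarrow> 'w measure"
    and X :: "real \<Rightarrow> 'w \<Rightarrow> 'v" and \<theta> :: "real \<Rightarrow> 'w \<Rightarrow> 'w" and P :: "'v \<Rightarrow> 'w measure"
    and Z :: "'v set" and r :: "'v \<Rightarrow> real"
  assumes "isotropic_potential Q g R0"
    and "hunt_process Q M F X \<theta> P"
    and "countable Z" and "0 \<notin> Z"
    and "\<And>z. z \<in> Z \<Longrightarrow> R0 < r z"
    and "disjoint_family_on (\<lambda>z. ball z (r z)) Z"
    and "separation_condition g Z r"
    and "(\<Sum>\<^sub>\<infinity>z\<in>Z. g (norm z) / g (r z)) = \<infinity>"
  shows "unavoidable X P (\<Union>z\<in>Z. ball z (r z))"
proof -
  interpret isotropic_potential Q g R0 by fact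
  interpret hunt_process Q M F X \<theta> P by fact
  have rpos: "0 < r z" if "z \<in> Z" for z using assms(5)[OF that] R0_nonneg by simp
  obtain e where e: "0 < e" "\<And>z z'. z \<in> Z \<Longrightarrow> z' \<in> Z \<Longrightarrow> z \<noteq> z' \<Longrightarrow> e * norm z ^ DIM('v) * weight r z \<le> norm (z - z') ^ DIM('v)"
    using separation_condition_real[OF assms(7,4) rpos] by blast
  have centre_outside: "r z \<le> norm (z - z')" if "z \<in> Z" "z' \<in> Z" "z \<noteq> z'" for z z'
  proof (rule ccontr)
    assume "\<not> r z \<le> norm (z - z')"
    then have "z' \<in> ball z (r z) \<inter> ball z' (r z')" using rpos[OF that(2)] by (simp add: dist_norm)
    then show False using disjoint_family_onD[OF assms(6) that] by blast
  qed
  define K3 where "K3 = 6 ^ DIM('v) * C_LD * C_dbl / e"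
  define K where "K = 3 ^ DIM('v) * C_LD * (1 + C_dbl * (C_dbl + K3))"
  have K3: "0 \<le> K3" using C_LD(1) C_dbl_ge_1 e(1) by (simp add: K3_def)
  have K: "0 < K" unfolding K_def using C_LD(1) C_dbl_ge_1 K3 by (intro mult_pos_pos add_pos_nonneg) auto
  show ?thesis
  proof (rule unavoidable_if_potentials)
    show "open (\<Union>z\<in>Z. ball z (r z))" by auto
    show "0 < 1 / (C_dbl\<^sup>2 * K)" using K C_dbl_ge_1 by simp
    fix N :: real
    \<comment> \<open>Excluded are the finitely many centres that are not far enough away, and the balls that contain the
      origin, of which there is at most one.\<close>
    define E where "E = Z \<inter> cball 0 (max N R0) \<union> {z \<in> Z. norm z < r z}"
    have "finite (Z \<inter> cball 0 (max N R0))"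
      using assms(7) by (simp add: separation_condition_def locally_finite_set_def)
    moreover have "finite {z \<in> Z. norm z < r z}"
    proof -
      have "z = z'" if "z \<in> Z" "z' \<in> Z" "norm z < r z" "norm z' < r z'" for z z'
      proof (rule ccontr)
        assume "z \<noteq> z'"
        then have "ball z (r z) \<inter> ball z' (r z') = {}" using assms(6) that by (auto simp: disjoint_family_on_def)
        moreover have "0 \<in> ball z (r z) \<inter> ball z' (r z')" using that by simp
        ultimately show False by blast
      qed
      then have sub: "{z \<in> Z. norm z < r z} \<subseteq> {z}" if "z \<in> {z \<in> Z. norm z < r z}" for z
        using that by blast
      show ?thesis
      proof (cases "{z \<in> Z. norm z < r z} = {}")
        case False
        then obtain z where "z \<in> {z \<in> Z. norm z < r z}" by blast
        then show ?thesis by (rule finite_subset[OF sub]) simp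
      qed (simp only: finite.emptyI)
    qed
    ultimately have finE: "finite E" by (simp add: E_def)
    have quot: "g (norm z) / g (r z) = ennreal (weight r z)" "0 < weight r z" if "z \<in> Z" for z
    proof -
      have pos: "0 < norm z" "0 < r z" using that assms(4) rpos by auto
      note Gpos = pos[THEN G_pos]
      show "g (norm z) / g (r z) = ennreal (weight r z)" "0 < weight r z"
        using Gpos pos by (auto simp: g_eq weight_def divide_ennreal)
    qed
    have "g (norm z) / g (r z) < \<infinity>" if "z \<in> E" for z
      using that quot[of z] by (auto simp: E_def)
    then obtain B where B: "finite B" "B \<subseteq> Z - E" "1 \<le> (\<Sum>z\<in>B. g (norm z) / g (r z))"
      using finite_subset_sum_ge_1[OF assms(8) finE] by metis
    have BZ: "z \<in> Z" "R0 < r z" "r z \<le> norm z" "N \<le> norm z" "R0 < norm z" if "z \<in> B" for z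
      using B(2) that assms(5)[of z] by (auto simp: E_def)
    define S where "S = sum (weight r) B"
    have "(\<Sum>z\<in>B. g (norm z) / g (r z)) = ennreal S"
      unfolding S_def using quot BZ(1) by (subst sum_ennreal[symmetric]) (auto simp: less_imp_le)
    then have S: "1 \<le> S" using B(3) by simp
    \<comment> \<open>As \<open>S \<ge> 1\<close>, the additive constants are absorbed into a multiple of \<open>S\<close>.\<close>
    have upper: "potential_kernel Q (normalized_balls B r) y \<le> ennreal (K * S)" for y
    proof -
      have "potential_kernel Q (normalized_balls B r) y \<le> ennreal (3 ^ DIM('v) * C_LD * (1 + C_dbl * (C_dbl * S + K3)))"
        unfolding S_def K3_def using B(1) e(1) BZ e(2) centre_outside
        by (intro potential_normalized_balls_le) auto
      also have "1 + C_dbl * (C_dbl * S + K3) \<le> 1 * S + C_dbl * (C_dbl * S + K3 * S)"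
        using S K3 C_dbl_ge_1 by (intro add_mono mult_left_mono order_refl) (auto simp: mult_le_cancel_left1)
      then have "3 ^ DIM('v) * C_LD * (1 + C_dbl * (C_dbl * S + K3)) \<le> 3 ^ DIM('v) * C_LD * (1 * S + C_dbl * (C_dbl * S + K3 * S))"
        using C_LD(1) by (intro mult_left_mono) auto
      also have "\<dots> = K * S" by (simp add: K_def algebra_simps)
      finally show ?thesis by (simp add: ennreal_leI)
    qed
    have lower: "ennreal (1 / (C_dbl\<^sup>2 * K) * (K * S)) \<le> potential_kernel Q (normalized_balls B r) y" if "norm y \<le> N" for y
    proof -
      have "ennreal (S / C_dbl\<^sup>2) \<le> potential_kernel Q (normalized_balls B r) y"
        unfolding S_def using B(1) BZ that by (intro potential_normalized_balls_ge) (auto intro: order_trans)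
      then show ?thesis using K by simp
    qed
    have "normalized_balls B r y = 0" if "y \<notin> (\<Union>z\<in>Z. ball z (r z))" for y
      using that BZ(1) by (intro normalized_balls_zero_outside) auto
    then show "\<exists>f c. f \<in> borel_measurable borel \<and> (\<forall>y. y \<notin> (\<Union>z\<in>Z. ball z (r z)) \<longrightarrow> f y = 0) \<and> 0 < c \<and>
      (\<forall>y. potential_kernel Q f y \<le> ennreal c) \<and>
      (\<forall>y. norm y \<le> N \<longrightarrow> ennreal (1 / (C_dbl\<^sup>2 * K) * c) \<le> potential_kernel Q f y)"
      using upper lower K S
      by (intro exI[of _ "normalized_balls B r"] exI[of _ "K * S"]) auto
  qed
qed

end
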